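(* For $q\in\mathbb{C}$ with $|q|<1$, $$\sum_{i,j\geq 0}\frac{q^{2i^2+2ij+\frac{1}{2}j^2+\frac{1}{2}j}}{(q;q)_{2i}(q;q)_{j}}=\frac{(q^{4},q^{16},q^{20};q^{20})_{\infty}(q^{12},q^{28};q^{40})_{\infty}}{(q;q)_{\infty}},$$ $$\sum_{i,j\geq 0} \frac{q^{2i^2+2ij+\frac{1}{2}j^2+2i+\frac{3}{2}j}}{(q;q)_{2i+1}(q;q)_{j}}=\frac{(q^{6},q^{14},q^{20};q^{20})_{\infty}(q^{8},q^{32};q^{40})_{\infty}}{(q;q)_{\infty}},$$ $$\sum_{i,j\geq 0} \frac{q^{2i^2+2ij+\frac{1}{2}j^2+2i+\frac{1}{2}j}}{(q;q)_{2i}(q;q)_{j}}=\frac{(q^{2},q^{18},q^{20};q^{20})_{\infty}(q^{16},q^{24};q^{40})_{\infty}}{(q;q)_{\infty}},$$ $$\sum_{i,j\geq 0} \frac{q^{2i^2+2ij+\frac{1}{2}j^2+4i+\frac{3}{2}j}}{(q;q)_{2i+1}(q;q)_{j}}=\frac{(q^{8},q^{12},q^{20};q^{20})_{\infty}(q^{4},q^{36};q^{40})_{\infty}}{(q;q)_{\infty}}.$$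
   Context: For $|q|<1$: $(a;q)_\infty=\prod_{k\ge0}(1-aq^k)$; for integers $n\ge0$, $(a;q)_n=\prod_{k=0}^{n-1}(1-aq^k)$; and $(a_1,\dots,a_m;q)_\infty=\prod_{k=1}^m(a_k;q)_\infty$. All exponents of $q$ appearing are integers. *)

theory Defs
  imports "HOL-Analysis.Analysis"
begin

definition qpoch :: "complex \<Rightarrow> complex \<Rightarrow> nat \<Rightarrow> complex" where
  "qpoch a q n = (\<Prod>k<n. 1 - a * q ^ k)"

(* The product converges for norm q < 1; this is the only range in which the definition is used. *)
definition qpoch_inf :: "complex \<Rightarrow> complex \<Rightarrow> complex" where
  "qpoch_inf a q = (\<Prod>k. 1 - a * q ^ k)"

(* The multi-parameter symbol (a1, ..., am; q)_infinity, with the parameters given as a list. *)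
definition qpochs_inf :: "complex list \<Rightarrow> complex \<Rightarrow> complex" where
  "qpochs_inf as q = (\<Prod>a\<leftarrow>as. qpoch_inf a q)"

(* The half-integer parts j^2/2 + j/2 and j^2/2 + 3j/2 of the exponents are written
   (j^2 + j) div 2 and (j^2 + 3 * j) div 2; the next two facts say that this division is exact. *)
lemma real_triangle_div2: "real ((j\<^sup>2 + j) div 2) = (real j)\<^sup>2 / 2 + real j / 2"
proof -
  have "even (j\<^sup>2 + j)" by simp
  then show ?thesis by (simp add: real_of_nat_div add_divide_distrib)
qed

lemma real_triangle3_div2: "real ((j\<^sup>2 + 3 * j) div 2) = (real j)\<^sup>2 / 2 + 3 / 2 * real j"
proof -
  have "even (j\<^sup>2 + 3 * j)" by simp
  then show ?thesis by (simp add: real_of_nat_div add_divide_distrib)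
qed

end

(* Put q = p^2. With n = m + j, the first pair of double sums runs over p^(n^2 + j) / ((q;q)_m (q;q)_j)
   for even and for odd m, and replacing p by -p multiplies this term by (-1)^m. By a Rogers-Szego evaluation
   the inner sum over m + j = n collapses to p^(n^2) / (p;p)_n, so the two double sums are the even and
   odd parts in p of the first Rogers-Ramanujan function G(p); the second pair comes in the same way from
   H(p), with terms p^(n^2 + n + m). Since G(p) = f(p, p^9) / D(p^2) and H(p) = f(p^3, p^7) / D'(p^2)
   for Ramanujan's theta function f(a, b) and infinite products D and D', these parts are read off the
   splitting of f into its terms of even and odd index.
   The Rogers-Ramanujan identities are proved by comparing the recurrence F(a) = F(aq) + a F(aq^2)
   of the sum side, at a = q^(n+1), with that of the Rogers-Selberg series; at a = q and a = q^2 the latter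
   is a theta series, which the Jacobi triple product turns into a product. *)
theory Submission
  imports Defs "HOL-Library.Nat_Bijection"
begin

section \<open>Finite and infinite q-Pochhammer symbols\<close>

text \<open>The square root p enters because doubling the exponents completes squares: with m = 2i,
  2 (2i^2 + 2ij + (j^2 + j)/2) = (m + j)^2 + j. The products D and D' come from making the
  Rogers-Ramanujan denominators even in p. For instance G(p) = 1 / ((p, p^9; p^10)_inf (p^4, p^6;
  p^10)_inf); multiplying above and below by (-p, -p^9, p^10; p^10)_inf turns the first factor below
  into (p^2, p^18; p^20)_inf and puts f(p, p^9) on top, so that odd powers of p come from the theta
  function alone. The odd part is p (or p^3) times a function of q, and this factor has to be
  cancelled; hence q = 0 is a separate case. The sums over pairs are unconditional, so regrouping
  them rests on a geometric majorant. The recurrence is compared along sequences in n rather than on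
  power series in a: what singles out a solution is its limit as n grows.\<close>

lemma qpoch_0 [simp]: "qpoch a q 0 = 1"
  by (simp add: qpoch_def)

lemma qpoch_Suc: "qpoch a q (Suc n) = qpoch a q n * (1 - a * q ^ n)"
  by (simp add: qpoch_def)

lemma one_minus_power_nonzero:
  fixes q :: "'a :: real_normed_div_algebra"
  assumes "norm q < 1" "n > 0"
  shows "1 - q ^ n \<noteq> 0"
proof
  assume "1 - q ^ n = 0"
  then have "norm q ^ n = 1" by (metis norm_one norm_power eq_iff_diff_eq_0)
  with assms show False
    by (metis norm_ge_zero order_less_irrefl power_strict_mono power_one)
qed

lemma qpoch_nonzero: "norm q < 1 \<Longrightarrow> qpoch q q n \<noteq> 0"
  using one_minus_power_nonzero[of q "Suc k" for k] unfolding qpoch_def by simp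

lemma convergent_prod_qpoch:
  fixes a q :: complex
  assumes "norm q < 1"
  shows "convergent_prod (\<lambda>k. 1 - a * q ^ k)"
proof -
  have "summable (\<lambda>k. norm a * norm q ^ k)"
    using assms by (intro summable_mult summable_geometric) simp
  then have "summable (\<lambda>k. norm ((1 - a * q ^ k) - 1))"
    by (simp add: norm_mult norm_power)
  then show ?thesis
    by (intro abs_convergent_prod_imp_convergent_prod summable_imp_abs_convergent_prod)
qed

lemma qpoch_tendsto:
  assumes "norm q < 1"
  shows "qpoch a q \<longlonglongrightarrow> qpoch_inf a q"
  using has_prod_imp_tendsto'[OF convergent_prod_has_prod[OF convergent_prod_qpoch[OF assms]]]
  by (simp add: qpoch_def[abs_def] qpoch_inf_def)

lemma qpoch_inf_nonzero:
  assumes "norm q < 1" "norm a < 1"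
  shows "qpoch_inf a q \<noteq> 0"
  unfolding qpoch_inf_def
proof (rule prodinf_nonzero[OF convergent_prod_qpoch[OF assms(1)]])
  fix i
  have "norm (a * q ^ i) \<le> norm a"
    using assms by (simp add: norm_mult norm_power mult_left_le power_le_one)
  then show "1 - a * q ^ i \<noteq> 0"
    using assms(2) by auto
qed

lemma qpoch_bounded:
  assumes "norm q < 1"
  obtains K where "K > 0" "\<And>n. norm (qpoch a q n) \<le> K"
proof -
  have "Bseq (qpoch a q)"
    using qpoch_tendsto[OF assms] convergent_imp_Bseq convergent_def by blast
  then show ?thesis using that by (auto elim: BseqE)
qed

text \<open>The symbols converge to a nonzero limit, so their reciprocals stay bounded. This
  constant dominates the terms of the series below that have \<open>qpoch\<close> in the
  denominator.\<close>

lemma inverse_qpoch_bounded: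
  assumes "norm q < 1"
  obtains K where "K > 0" "\<And>n. norm (inverse (qpoch q q n)) \<le> K"
proof -
  have "(\<lambda>n. inverse (qpoch q q n)) \<longlonglongrightarrow> inverse (qpoch_inf q q)"
    using assms by (intro tendsto_inverse qpoch_tendsto qpoch_inf_nonzero)
  then have "Bseq (\<lambda>n. inverse (qpoch q q n))"
    using convergent_imp_Bseq convergent_def by blast
  then show ?thesis using that by (auto elim: BseqE)
qed

lemma qpoch_mult_dissect: "qpoch a q (m * n) = (\<Prod>i<m. qpoch (a * q ^ i) (q ^ m) n)"
proof -
  have "qpoch a q (n * m) = (\<Prod>k<n. \<Prod>i<m. 1 - a * q ^ (i + k * m))"
    unfolding qpoch_def
    using prod.shift_bounds_nat_ivl[of "\<lambda>k. 1 - a * q ^ k" 0 "_ * m" m]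
    by (simp add: prod.nat_group[symmetric] add.commute atLeast0LessThan)
  also have "\<dots> = (\<Prod>i<m. qpoch (a * q ^ i) (q ^ m) n)"
    unfolding qpoch_def by (subst prod.swap) (simp add: power_add power_mult[symmetric] mult_ac)
  finally show ?thesis by (simp add: mult.commute)
qed

text \<open>The limit is taken along the multiples of \<open>m\<close>, so the sorting of factors by
  their exponent modulo \<open>m\<close> happens only in finite products.\<close>

lemma qpoch_inf_dissect:
  assumes "norm q < 1" "m > 0"
  shows "qpoch_inf a q = (\<Prod>i<m. qpoch_inf (a * q ^ i) (q ^ m))"
proof -
  have m: "norm (q ^ m) < 1"
    using assms by (simp add: norm_power power_less_one_iff)
  have "(\<lambda>n. qpoch a q (m * n)) \<longlonglongrightarrow> qpoch_inf a q"
    using filterlim_compose[OF qpoch_tendsto[OF assms(1)] mult_nat_left_at_top[OF assms(2)]] .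
  moreover have "(\<lambda>n. qpoch a q (m * n)) \<longlonglongrightarrow> (\<Prod>i<m. qpoch_inf (a * q ^ i) (q ^ m))"
    unfolding qpoch_mult_dissect by (intro tendsto_prod qpoch_tendsto m)
  ultimately show ?thesis by (rule LIMSEQ_unique)
qed

lemma qpoch_inf_mult_neg:
  assumes "norm q < 1"
  shows "qpoch_inf a q * qpoch_inf (- a) q = qpoch_inf (a\<^sup>2) (q\<^sup>2)"
proof -
  have q2: "norm (q\<^sup>2) < 1"
    using assms by (simp add: norm_power power_less_one_iff)
  have "qpoch a q n * qpoch (- a) q n = qpoch (a\<^sup>2) (q\<^sup>2) n" for n
    unfolding qpoch_def
    by (subst prod.distrib[symmetric], intro prod.cong)
       (simp_all add: algebra_simps power2_eq_square power_mult_distrib)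
  then have "qpoch (a\<^sup>2) (q\<^sup>2) = (\<lambda>n. qpoch a q n * qpoch (- a) q n)"
    by auto
  then have "qpoch (a\<^sup>2) (q\<^sup>2) \<longlonglongrightarrow> qpoch_inf a q * qpoch_inf (- a) q"
    by (simp only:) (intro tendsto_mult qpoch_tendsto assms)
  then show ?thesis
    using LIMSEQ_unique qpoch_tendsto[OF q2] by blast
qed

text \<open>Dominated convergence: the enumeration \<open>h\<close> reduces it to series over the
  naturals, and absolute convergence of the limit series turns the value back into an unconditional
  sum.\<close>

lemma tannery_has_sum:
  fixes f :: "nat \<Rightarrow> 'a \<Rightarrow> 'b :: {real_normed_algebra, banach}" and h :: "nat \<Rightarrow> 'a"
  assumes h: "bij h"
    and limit: "\<And>k. (\<lambda>n. f n k) \<longlonglongrightarrow> g k"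
    and bound: "\<And>n k. norm (f n k) \<le> M k"
    and M: "M summable_on UNIV"
    and sums: "\<And>n. (f n has_sum s n) UNIV"
    and s: "s \<longlonglongrightarrow> S"
  shows "(g has_sum S) UNIV"
proof -
  have M': "summable (\<lambda>k. M (h k))"
    using M by (intro summable_on_imp_summable) (simp only: summable_on_reindex_bij_betw[OF h])
  have *: "eventually (\<lambda>n. summable (\<lambda>k. norm (f n (h k)))) sequentially \<and>
           summable (\<lambda>k. norm (g (h k))) \<and>
           ((\<lambda>n. suminf (\<lambda>k. f n (h k))) \<longlonglongrightarrow> suminf (\<lambda>k. g (h k)))"
  proof (rule tannerys_theorem[where M = "\<lambda>k. M (h k)"])
    show "eventually (\<lambda>(k, n). norm (f n (h k)) \<le> M (h k)) (sequentially \<times>\<^sub>F sequentially)"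
      by (rule always_eventually) (simp add: bound split_beta)
    show "(\<lambda>n. f n (h k)) \<longlonglongrightarrow> g (h k)" for k
      by (rule limit)
  qed (rule M', rule sequentially_bot)
  have "(\<lambda>k. f n (h k)) sums s n" for n
    using sums by (intro has_sum_imp_sums) (simp only: has_sum_reindex_bij_betw[OF h])
  then have "suminf (\<lambda>k. f n (h k)) = s n" for n
    by (simp add: sums_iff)
  with * have "s \<longlonglongrightarrow> suminf (\<lambda>k. g (h k))"
    by simp
  then have "suminf (\<lambda>k. g (h k)) = S"
    using s by (rule LIMSEQ_unique)
  moreover have "summable (\<lambda>k. norm (g (h k)))"
    using * by blast
  ultimately have "((\<lambda>k. g (h k)) has_sum S) UNIV"
    by (intro norm_summable_imp_has_sum) (simp_all add: sums_iff summable_norm_cancel)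
  then show ?thesis
    by (simp only: has_sum_reindex_bij_betw[OF h])
qed

text \<open>The integers are cut into n and -1 - n because \<open>tri (- 1 - j) = tri j\<close>;
  theta series are later folded along the same symmetry.\<close>

lemma has_sum_int_split:
  fixes f :: "int \<Rightarrow> 'a :: topological_comm_monoid_add"
  assumes "((\<lambda>n. f (int n)) has_sum a) UNIV" "((\<lambda>n. f (- 1 - int n)) has_sum b) UNIV"
  shows "(f has_sum (a + b)) UNIV"
proof -
  have 1: "(f has_sum a) (range int)"
    by (rule iffD2[OF has_sum_reindex]) (use assms(1) in \<open>simp_all add: o_def\<close>)
  have 2: "(f has_sum b) (range (\<lambda>n. - 1 - int n))"
    by (rule iffD2[OF has_sum_reindex]) (use assms(2) in \<open>simp_all add: o_def inj_on_def\<close>)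
  have "k \<in> range int \<union> range (\<lambda>n. - 1 - int n)" for k
  proof (cases "k \<ge> 0")
    case True
    then have "k = int (nat k)" by simp
    then show ?thesis by blast
  next
    case False
    then have "k = - 1 - int (nat (- 1 - k))" by simp
    then show ?thesis by blast
  qed
  then have U: "range int \<union> range (\<lambda>n. - 1 - int n) = UNIV"
    by blast
  have "range int \<inter> range (\<lambda>n. - 1 - int n) = {}"
    by auto
  from has_sum_Un_disjoint[OF 1 2 this] show ?thesis
    unfolding U .
qed

lemma summable_on_power_nat_abs:
  fixes c :: real
  assumes "0 \<le> c" "c < 1"
  shows "(\<lambda>j::int. c ^ nat \<bar>j\<bar>) summable_on UNIV"
proof -
  have 0: "(\<lambda>n. c ^ n) summable_on UNIV"
    using assms by (intro norm_summable_imp_summable_on) simp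
  then have "(\<lambda>n. c * c ^ n) summable_on UNIV"
    by (rule summable_on_cmult_right)
  moreover have "nat \<bar>- 1 - int n\<bar> = Suc n" for n by simp
  ultimately have "((\<lambda>j::int. c ^ nat \<bar>j\<bar>) has_sum ((\<Sum>\<^sub>\<infinity>n. c ^ n) + (\<Sum>\<^sub>\<infinity>n. c * c ^ n))) UNIV"
    using has_sum_infsum[OF 0] by (intro has_sum_int_split) simp_all
  then show ?thesis by (rule has_sum_imp_summable)
qed

section \<open>The Jacobi triple product\<close>

text \<open>Writing the exponents of \<open>a\<close> and \<open>b\<close> as \<open>tri j\<close> and \<open>tri (- j)\<close>, i.e. j(j+1)/2 and j(j-1)/2, keeps them
  natural numbers for all integers \<open>j\<close> and makes the theta series symmetric under exchanging
  \<open>a\<close> and \<open>b\<close>, so no division by \<open>a\<close> or \<open>b\<close> is ever needed.\<close>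

definition tri :: "int \<Rightarrow> nat" where
  "tri j = nat (j * (j + 1) div 2)"

lemma int_tri: "2 * int (tri j) = j * (j + 1)"
proof -
  have "even (j * (j + 1))" by simp
  moreover have "j * (j + 1) \<ge> 0"
    by (cases "j \<ge> 0") (auto simp: mult_nonpos_nonpos)
  ultimately show ?thesis unfolding tri_def by simp
qed

text \<open>Equations between triangular numbers are proved after doubling and passing to the
  integers, where \<open>int_tri\<close> makes them polynomial identities.\<close>

lemma nat_eqI_double: "2 * int m = 2 * int n \<Longrightarrow> m = n"
  by simp

text \<open>The two exponents add up to j^2. The weaker bound by the absolute value of j already
  gives theta series a geometric majorant.\<close>

lemma tri_pair_ge: "nat \<bar>j\<bar> \<le> tri j + tri (- j)"
proof -
  have "2 * int (tri j + tri (- j)) = 2 * (j * j)"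
    using int_tri[of j] int_tri[of "- j"] by (simp add: algebra_simps)
  moreover have "\<bar>j\<bar> \<le> j * j"
    using mult_left_mono[of 1 "\<bar>j\<bar>" "\<bar>j\<bar>"] by (cases "j = 0") (simp_all add: abs_mult_self_eq)
  ultimately have "\<bar>j\<bar> \<le> int (tri j + tri (- j))" by simp
  then show ?thesis by (simp only: nat_le_iff)
qed

lemma norm_theta_term_le:
  fixes a b :: complex
  assumes "norm a \<le> c" "norm b \<le> c" "c < 1"
  shows "norm (a ^ tri j * b ^ tri (- j)) \<le> c ^ nat \<bar>j\<bar>"
proof -
  have c: "0 \<le> c" using assms(1) norm_ge_zero order_trans by blast
  have "norm (a ^ tri j * b ^ tri (- j)) \<le> c ^ tri j * c ^ tri (- j)"
    using assms c by (simp add: norm_mult norm_power mult_mono power_mono)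
  also have "\<dots> \<le> c ^ nat \<bar>j\<bar>"
    unfolding power_add[symmetric] using tri_pair_ge c assms(3) by (intro power_decreasing) auto
  finally show ?thesis .
qed

text \<open>The lower index is an integer and the value is 0 outside the triangle, so finite sums
  can be written over all integers and shifted without boundary terms.\<close>

definition gauss_binom :: "complex \<Rightarrow> nat \<Rightarrow> int \<Rightarrow> complex" where
  "gauss_binom x n k =
     (if 0 \<le> k \<and> k \<le> int n then qpoch x x n / (qpoch x x (nat k) * qpoch x x (n - nat k)) else 0)"

lemma gauss_binom_sym: "gauss_binom x n (int n - k) = gauss_binom x n k"
proof (cases "0 \<le> k \<and> k \<le> int n")
  case True
  then have "n - nat (int n - k) = nat k" "nat (int n - k) = n - nat k" by auto
  with True show ?thesis by (simp add: gauss_binom_def mult.commute)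
qed (auto simp: gauss_binom_def)

lemma gauss_binom_eq:
  "gauss_binom x (l + m) (int l) = qpoch x x (l + m) / (qpoch x x l * qpoch x x m)"
  by (simp add: gauss_binom_def)

text \<open>One of the two q-Pascal rules. Where \<open>nat\<close> truncates the exponent, the
  binomial next to it is 0.\<close>

lemma gauss_binom_Suc:
  assumes x: "norm x < 1"
  shows "gauss_binom x (Suc n) k = gauss_binom x n k + x ^ nat (int n + 1 - k) * gauss_binom x n (k - 1)"
proof -
  note nz = qpoch_nonzero[OF x]
  consider "k < 0 \<or> k > int n + 1" | "k = 0" | "k = int n + 1" | "1 \<le> k" "k \<le> int n"
    by linarith
  then show ?thesis
  proof cases
    case 4
    define l where "l = nat k - 1"
    define m where "m = n - nat k"
    have k: "k = int (Suc l)" and n: "n = Suc (l + m)"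
      using 4 by (auto simp: l_def m_def)
    have s: "1 - x * x ^ i \<noteq> 0" for i
      using one_minus_power_nonzero[OF x, of "Suc i"] by simp
    define A B C where "A = qpoch x x l" and "B = qpoch x x m" and "C = qpoch x x n"
    have nz': "A \<noteq> 0" "B \<noteq> 0"
      using nz by (simp_all add: A_def B_def)
    have g1: "gauss_binom x (Suc n) k = C * (1 - x * x ^ n) / (A * (1 - x * x ^ l) * (B * (1 - x * x ^ m)))"
      using gauss_binom_eq[of x "Suc l" "Suc m"] by (simp add: k n A_def B_def C_def qpoch_Suc)
    have g2: "gauss_binom x n k = C / (A * (1 - x * x ^ l) * B)"
      using gauss_binom_eq[of x "Suc l" m] by (simp add: k n A_def B_def C_def qpoch_Suc)
    have g3: "gauss_binom x n (k - 1) = C / (A * (B * (1 - x * x ^ m)))"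
      using gauss_binom_eq[of x l "Suc m"] by (simp add: k n A_def B_def C_def qpoch_Suc)
    have e: "nat (int n + 1 - k) = Suc m"
      by (simp add: k n)
    \<comment> \<open>The whole rule rests on this splitting of the top factor: each summand cancels
      one of the two extra factors in the denominator.\<close>
    have eq: "1 - x * x ^ n = (1 - x * x ^ m) + x ^ Suc m * (1 - x * x ^ l)"
      by (simp add: n power_add algebra_simps)
    have "C * (T + X * S) / (A * S * (B * T)) = C / (A * S * B) + X * (C / (A * (B * T)))"
      if "S \<noteq> 0" "T \<noteq> 0" for S T X
      using nz' that by (simp add: field_simps)
    then show ?thesis
      unfolding g1 g2 g3 e eq using s by blast
  qed (auto simp: gauss_binom_def nz nat_add_distrib)
qed

text \<open>The other q-Pascal rule is the reflection of the first under k -> n + 1 - k.\<close>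

lemma gauss_binom_Suc':
  assumes x: "norm x < 1"
  shows "gauss_binom x (Suc n) k = gauss_binom x n (k - 1) + x ^ nat k * gauss_binom x n k"
proof -
  have "gauss_binom x (Suc n) k = gauss_binom x (Suc n) (int (Suc n) - k)"
    by (rule gauss_binom_sym[symmetric])
  also have "\<dots> = gauss_binom x n (int n - (k - 1)) + x ^ nat k * gauss_binom x n (int n - k)"
    by (subst gauss_binom_Suc[OF x]) (simp add: algebra_simps)
  finally show ?thesis unfolding gauss_binom_sym .
qed

text \<open>A two-sided form of the q-binomial theorem. Raising \<open>N\<close> or \<open>M\<close>
  by one multiplies the product by one factor, which adds to the sum a copy of itself shifted by
  one; the two q-Pascal rules merge both copies, one rule for each parameter.\<close>

lemma finite_jacobi_triple_product:
  fixes a b :: complex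
  assumes x: "norm (a * b) < 1"
  shows "((\<lambda>j. a ^ tri j * b ^ tri (- j) * gauss_binom (a * b) (M + N) (int M + j))
           has_sum (qpoch (- a) (a * b) N * qpoch (- b) (a * b) M)) UNIV"
proof (induction N arbitrary: M)
  case 0
  show ?case
  proof (induction M)
    case 0
    have *: "a ^ tri j * b ^ tri (- j) * gauss_binom (a * b) (0 + 0) (int 0 + j) = (if j = 0 then 1 else 0)" for j
      by (auto simp: tri_def gauss_binom_def)
    show ?case
      unfolding * by (intro has_sum_finite_neutralI[of "{0}"]) auto
  next
    case (Suc M)
    let ?t = "\<lambda>M j. a ^ tri j * b ^ tri (- j) * gauss_binom (a * b) (M + 0) (int M + j)"
    have "((\<lambda>j. ?t M (j + 1)) has_sum (qpoch (- a) (a * b) 0 * qpoch (- b) (a * b) M)) UNIV"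
      using Suc by (subst has_sum_reindex_bij_witness[of UNIV "\<lambda>j. j - 1" "\<lambda>j. j + 1" UNIV]) auto
    then have "((\<lambda>j. ?t M j + b * (a * b) ^ M * ?t M (j + 1)) has_sum
       (qpoch (- a) (a * b) 0 * qpoch (- b) (a * b) M
          + b * (a * b) ^ M * (qpoch (- a) (a * b) 0 * qpoch (- b) (a * b) M))) UNIV"
      using Suc by (intro has_sum_add has_sum_cmult_right)
    moreover have "?t (Suc M) j = ?t M j + b * (a * b) ^ M * ?t M (j + 1)" for j
    \<comment> \<open>Outside this range all three Gaussian binomials vanish; inside it the
      conversions to \<open>nat\<close> are exact.\<close>
    proof (cases "j \<le> 0 \<and> int M + j + 1 \<ge> 0")
      case True
      have e1: "tri (- j) = tri (- (j + 1)) + nat (- j)"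
        using True int_tri[of "- j"] int_tri[of "- (j + 1)"]
        by (intro nat_eqI_double) (simp add: algebra_simps)
      have e2: "M + tri (j + 1) = tri j + nat (int M + j + 1)"
        using True int_tri[of j] int_tri[of "j + 1"]
        by (intro nat_eqI_double) (simp add: algebra_simps)
      have e3: "nat (int M + j + 1) + nat (- j) = M + 1"
        using True by linarith
      have "gauss_binom (a * b) (Suc M) (int (Suc M) + j)
        = gauss_binom (a * b) M (int M + j)
          + (a * b) ^ nat (int M + j + 1) * gauss_binom (a * b) M (int M + j + 1)"
        using gauss_binom_Suc'[OF x, of M "int (Suc M) + j"] by (simp add: algebra_simps)
      moreover have "b * (a * b) ^ M * (a ^ tri (j + 1) * b ^ tri (- (j + 1)))
        = a ^ tri j * b ^ tri (- j) * (a * b) ^ nat (int M + j + 1)"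
      proof -
        have "b * (a * b) ^ M * (a ^ tri (j + 1) * b ^ tri (- (j + 1)))
           = a ^ (M + tri (j + 1)) * b ^ (M + 1 + tri (- (j + 1)))"
          by (simp add: power_add power_mult_distrib)
        also have "\<dots> = a ^ (tri j + nat (int M + j + 1)) * b ^ (nat (int M + j + 1) + tri (- j))"
          unfolding e2 e1 e3[symmetric] by (simp add: ac_simps)
        finally show ?thesis by (simp add: power_add power_mult_distrib ac_simps)
      qed
      ultimately show ?thesis by (simp add: algebra_simps)
    qed (auto simp: gauss_binom_def)
    ultimately show ?case
      by (simp add: qpoch_Suc algebra_simps)
  qed
next
  case (Suc N)
  let ?t = "\<lambda>N j. a ^ tri j * b ^ tri (- j) * gauss_binom (a * b) (M + N) (int M + j)"
  have IH: "(?t N has_sum (qpoch (- a) (a * b) N * qpoch (- b) (a * b) M)) UNIV"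
    by (rule Suc.IH)
  then have "((\<lambda>j. ?t N (j - 1)) has_sum (qpoch (- a) (a * b) N * qpoch (- b) (a * b) M)) UNIV"
    by (subst has_sum_reindex_bij_witness[of UNIV "\<lambda>j. j + 1" "\<lambda>j. j - 1" UNIV]) auto
  then have "((\<lambda>j. ?t N j + a * (a * b) ^ N * ?t N (j - 1)) has_sum
     (qpoch (- a) (a * b) N * qpoch (- b) (a * b) M
        + a * (a * b) ^ N * (qpoch (- a) (a * b) N * qpoch (- b) (a * b) M))) UNIV"
    by (intro has_sum_add has_sum_cmult_right IH)
  moreover have "?t (Suc N) j = ?t N j + a * (a * b) ^ N * ?t N (j - 1)" for j
  \<comment> \<open>For larger \<open>j\<close> all three Gaussian binomials vanish, and up to this
    bound the Pascal exponent is not truncated.\<close>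
  proof (cases "j \<le> int N + 1")
    case True
    have e1: "int (tri j) = int (tri (j - 1)) + j"
      using int_tri[of j] int_tri[of "j - 1"] by (simp add: algebra_simps)
    have e2: "int (tri (- (j - 1))) = int (tri (- j)) - j + 1"
      using int_tri[of "- (j - 1)"] int_tri[of "- j"] by (simp add: algebra_simps)
    have e3: "tri j + nat (int N + 1 - j) = N + 1 + tri (j - 1)"
      using e1 True by simp
    have e4: "tri (- j) + nat (int N + 1 - j) = N + tri (- (j - 1))"
      using e2 True by simp
    have "gauss_binom (a * b) (M + Suc N) (int M + j)
      = gauss_binom (a * b) (M + N) (int M + j)
        + (a * b) ^ nat (int N + 1 - j) * gauss_binom (a * b) (M + N) (int M + (j - 1))"
      using gauss_binom_Suc[OF x, of "M + N" "int M + j"] by (simp add: algebra_simps)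
    moreover have "a * (a * b) ^ N * (a ^ tri (j - 1) * b ^ tri (- (j - 1)))
      = a ^ tri j * b ^ tri (- j) * (a * b) ^ nat (int N + 1 - j)"
    proof -
      have "a * (a * b) ^ N * (a ^ tri (j - 1) * b ^ tri (- (j - 1)))
         = a ^ (N + 1 + tri (j - 1)) * b ^ (N + tri (- (j - 1)))"
        by (simp add: power_add power_mult_distrib)
      also have "\<dots> = a ^ (tri j + nat (int N + 1 - j)) * b ^ (tri (- j) + nat (int N + 1 - j))"
        by (simp only: e3 e4)
      finally show ?thesis by (simp add: power_add power_mult_distrib ac_simps)
    qed
    ultimately show ?thesis by (simp add: algebra_simps)
  qed (auto simp: gauss_binom_def)
  ultimately show ?case
    by (simp add: qpoch_Suc algebra_simps)
qed

text \<open>The finite identity with M = N = n, as n grows: every Gaussian binomial tends to 1 /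
  (ab; ab)_inf, and the j-th term is at most a constant times c^|j|, where c < 1 bounds both |a| and
  |b|.\<close>

theorem jacobi_triple_product:
  fixes a b :: complex
  assumes a: "norm a < 1" and b: "norm b < 1"
  shows "((\<lambda>j. a ^ tri j * b ^ tri (- j)) has_sum
            (qpoch_inf (- a) (a * b) * qpoch_inf (- b) (a * b) * qpoch_inf (a * b) (a * b))) UNIV"
proof -
  define x where "x = a * b"
  define c where "c = max (norm a) (norm b)"
  have c: "norm a \<le> c" "norm b \<le> c" "c < 1" "0 \<le> c"
    using a b by (auto simp: c_def le_max_iff_disj)
  have x: "norm x < 1"
    unfolding x_def norm_mult using a b by (metis mult_strict_mono' mult_1 norm_ge_zero)
  obtain K where K: "K > 0" "\<And>n. norm (qpoch x x n) \<le> K"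
    using qpoch_bounded[OF x] by metis
  obtain L where L: "L > 0" "\<And>n. norm (inverse (qpoch x x n)) \<le> L"
    using inverse_qpoch_bounded[OF x] by metis
  have gb_bound: "norm (gauss_binom x n k) \<le> K * (L * L)" for n k
    unfolding gauss_binom_def divide_inverse
    using K L by (auto simp: norm_mult inverse_mult_distrib intro!: mult_mono)
  let ?P = "qpoch_inf x x"
  have P: "?P \<noteq> 0" using qpoch_inf_nonzero x by blast
  have gb_lim: "(\<lambda>n. gauss_binom x (n + n) (int n + j)) \<longlonglongrightarrow> inverse ?P" for j
  proof -
    have shift: "filterlim (\<lambda>n. nat (int n + i)) sequentially sequentially" for i
      unfolding filterlim_at_top
    proof
      fix Z
      show "\<forall>\<^sub>F n in sequentially. Z \<le> nat (int n + i)"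
        by (rule eventually_sequentiallyI[of "Z + nat \<bar>i\<bar>"]) linarith
    qed
    have double: "filterlim (\<lambda>n::nat. n + n) sequentially sequentially"
      using mult_nat_left_at_top[of 2] by (simp add: mult_2)
    have "(\<lambda>n. qpoch x x (n + n) / (qpoch x x (nat (int n + j)) * qpoch x x (nat (int n - j))))
            \<longlonglongrightarrow> ?P / (?P * ?P)"
      using P shift[of j] shift[of "- j"] double
      by (intro tendsto_divide tendsto_mult filterlim_compose[OF qpoch_tendsto[OF x]]) auto
    moreover have "eventually (\<lambda>n. gauss_binom x (n + n) (int n + j)
      = qpoch x x (n + n) / (qpoch x x (nat (int n + j)) * qpoch x x (nat (int n - j)))) sequentially"
    proof (rule eventually_sequentiallyI[of "nat \<bar>j\<bar>"])
      fix n assume "nat \<bar>j\<bar> \<le> n"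
      then have "0 \<le> int n + j" "int n + j \<le> int (n + n)" "n + n - nat (int n + j) = nat (int n - j)"
        by linarith+
      then show "gauss_binom x (n + n) (int n + j)
        = qpoch x x (n + n) / (qpoch x x (nat (int n + j)) * qpoch x x (nat (int n - j)))"
        by (simp add: gauss_binom_def)
    qed
    ultimately show ?thesis
      using P by (simp add: tendsto_cong field_simps)
  qed
  have "((\<lambda>j. a ^ tri j * b ^ tri (- j) * inverse ?P) has_sum
          (qpoch_inf (- a) x * qpoch_inf (- b) x)) UNIV"
  proof (rule tannery_has_sum[OF bij_int_decode])
    show "(\<lambda>n. a ^ tri k * b ^ tri (- k) * gauss_binom x (n + n) (int n + k))
            \<longlonglongrightarrow> a ^ tri k * b ^ tri (- k) * inverse ?P" for k
      by (intro tendsto_mult tendsto_const gb_lim)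
    show "norm (a ^ tri k * b ^ tri (- k) * gauss_binom x (n + n) (int n + k))
            \<le> c ^ nat \<bar>k\<bar> * (K * (L * L))" for n k
      unfolding norm_mult[of "_ * _"]
      by (intro mult_mono norm_theta_term_le gb_bound) (use c in auto)
    show "(\<lambda>k. c ^ nat \<bar>k\<bar> * (K * (L * L))) summable_on UNIV"
      using c by (intro summable_on_cmult_left summable_on_power_nat_abs)
    show "((\<lambda>k. a ^ tri k * b ^ tri (- k) * gauss_binom x (n + n) (int n + k)) has_sum
            (qpoch (- a) x n * qpoch (- b) x n)) UNIV" for n
      using finite_jacobi_triple_product[of a b n n] x by (simp add: x_def)
    show "(\<lambda>n. qpoch (- a) x n * qpoch (- b) x n) \<longlonglongrightarrow> qpoch_inf (- a) x * qpoch_inf (- b) x"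
      by (intro tendsto_mult qpoch_tendsto x)
  qed
  from has_sum_cmult_left[OF this, of ?P] show ?thesis
    using P by (simp add: x_def mult.assoc)
qed

section \<open>The Rogers-Ramanujan identities\<close>

lemma has_sum_int_fold:
  fixes f :: "int \<Rightarrow> 'a :: banach"
  assumes "(f has_sum S) UNIV"
  shows "((\<lambda>n. f (int n) + f (- 1 - int n)) has_sum S) UNIV"
proof -
  have s: "f summable_on A" for A
    using summable_on_subset_banach[OF has_sum_imp_summable[OF assms]] by blast
  have "((f \<circ> int) summable_on UNIV)"
    by (rule iffD1[OF summable_on_reindex s]) simp
  moreover have "((f \<circ> (\<lambda>n. - 1 - int n)) summable_on UNIV)"
    by (rule iffD1[OF summable_on_reindex s]) (simp add: inj_on_def)
  ultimately have 1: "((\<lambda>n. f (int n)) has_sum infsum (f \<circ> int) UNIV) UNIV"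
    and 2: "((\<lambda>n. f (- 1 - int n)) has_sum infsum (f \<circ> (\<lambda>n. - 1 - int n)) UNIV) UNIV"
    by (auto simp: o_def intro!: has_sum_infsum)
  have "S = infsum (f \<circ> int) UNIV + infsum (f \<circ> (\<lambda>n. - 1 - int n)) UNIV"
    using has_sum_unique[OF assms has_sum_int_split[OF 1 2]] .
  then show ?thesis
    using has_sum_add[OF 1 2] by simp
qed

lemma summable_power_mult_bounded:
  fixes q :: "'a :: {real_normed_field, banach}"
  assumes "norm q < 1" "\<And>r. r \<le> e r" "\<And>r. norm (c r) \<le> K"
  shows "summable (\<lambda>r. norm (q ^ e r * c r))"
proof (rule summable_comparison_test')
  show "summable (\<lambda>r. norm q ^ r * K)"
    using assms(1) by (intro summable_mult2 summable_geometric) simp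
  fix r
  have "norm q ^ e r * norm (c r) \<le> norm q ^ r * K"
    using assms by (intro mult_mono power_decreasing) auto
  then show "norm (norm (q ^ e r * c r)) \<le> norm q ^ r * K"
    by (simp add: norm_mult norm_power)
qed

text \<open>Moving one part of a series by one index, at no cost since its head is 0, is the
  rearrangement behind both relations between the Rogers-Selberg series.\<close>

lemma suminf_shift_part:
  fixes X Y :: "nat \<Rightarrow> 'a :: real_normed_vector"
  assumes "summable X" "summable Y" "Y 0 = 0"
  shows "(\<Sum>r. X r + Y r) = (\<Sum>r. X r + Y (Suc r))"
proof -
  have "summable (\<lambda>r. Y (Suc r))"
    using assms(2) by (simp add: summable_Suc_iff)
  then show ?thesis
    using assms suminf_split_head[OF assms(2)]
    by (simp add: suminf_add[symmetric])
qed

text \<open>Going from n + 1 down to n, the larger of two neighbouring norms grows at most by the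
  factor 1 + |q|^(n+1). The product of these factors converges, so the value at n is at most a
  constant times values arbitrarily far out, which tend to 0.\<close>

lemma power_recurrence_zero:
  fixes D :: "nat \<Rightarrow> complex"
  assumes q: "norm q < 1"
    and D: "\<And>n. D n = D (Suc n) + q ^ Suc n * D (Suc (Suc n))"
    and lim: "D \<longlonglongrightarrow> 0"
  shows "D n = 0"
proof -
  \<comment> \<open>The norm of q is made a complex number so that the growth factors form the
    symbol \<open>qpoch (- x) x n\<close>, which is known to be bounded.\<close>
  define x :: complex where "x = of_real (norm q)"
  have x: "norm x < 1" using q by (simp add: x_def)
  define c where "c n = norm (qpoch (- x) x n)" for n
  define M where "M n = max (norm (D n)) (norm (D (Suc n)))" for n
  have c_Suc: "c (Suc n) = c n * (1 + norm q ^ Suc n)" for n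
  proof -
    have "1 - (- x) * x ^ n = of_real (1 + norm q ^ Suc n)"
      by (simp add: x_def)
    then have "norm (1 - (- x) * x ^ n) = 1 + norm q ^ Suc n"
      by (simp only: norm_of_real) simp
    then show ?thesis
      by (simp only: c_def qpoch_Suc norm_mult)
  qed
  have c_pos: "c n > 0" for n
    by (induction n) (auto simp: c_Suc c_def[of 0] add_pos_nonneg)
  have M_step: "M n \<le> (1 + norm q ^ Suc n) * M (Suc n)" for n
  proof -
    have "norm (D n) \<le> norm (D (Suc n)) + norm q ^ Suc n * norm (D (Suc (Suc n)))"
      by (subst D) (metis norm_mult norm_power norm_triangle_ineq)
    also have "\<dots> \<le> M (Suc n) + norm q ^ Suc n * M (Suc n)"
      by (intro add_mono mult_left_mono) (auto simp: M_def)
    finally have 1: "norm (D n) \<le> (1 + norm q ^ Suc n) * M (Suc n)"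
      by (simp add: algebra_simps)
    have "0 \<le> M (Suc n)" by (simp add: M_def le_max_iff_disj)
    then have "M (Suc n) \<le> (1 + norm q ^ Suc n) * M (Suc n)"
      by (simp add: algebra_simps)
    moreover have "norm (D (Suc n)) \<le> M (Suc n)"
      by (simp add: M_def)
    ultimately show ?thesis using 1 by (simp add: M_def)
  qed
  have "c n * M n \<le> c (Suc n) * M (Suc n)" for n
    using mult_left_mono[OF M_step[of n], of "c n"] c_pos[of n] by (simp add: c_Suc mult_ac)
  then have mono: "c n * M n \<le> c N * M N" if "n \<le> N" for N
    using lift_Suc_mono_le[of "\<lambda>n. c n * M n", OF _ that] by simp
  obtain K where K: "K > 0" "\<And>n. c n \<le> K"
    unfolding c_def using qpoch_bounded[OF x] by metis
  have lim_M: "(\<lambda>N. K * M N) \<longlonglongrightarrow> K * max 0 0"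
    unfolding M_def
    using tendsto_norm_zero[OF lim] LIMSEQ_Suc[OF tendsto_norm_zero[OF lim]]
    by (intro tendsto_mult tendsto_const tendsto_max)
  have "c n * M n \<le> K * M N" if "n \<le> N" for N
    using mono[OF that] mult_right_mono[OF K(2)[of N], of "M N"] by (simp add: M_def le_max_iff_disj)
  then have "c n * M n \<le> K * max 0 0"
    by (intro LIMSEQ_le_const[OF lim_M]) blast
  then have "c n * M n \<le> 0" by simp
  then have "M n \<le> 0"
    using c_pos[of n] by (simp add: mult_le_0_iff)
  then show ?thesis by (simp add: M_def)
qed

text \<open>The numbers r(5r+1)/2 are the analogue for modulus 5 of the pentagonal numbers
  r(3r+1)/2.\<close>

definition pent :: "nat \<Rightarrow> nat" where
  "pent r = (5 * r\<^sup>2 + r) div 2"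

lemma two_pent: "2 * pent r = 5 * r\<^sup>2 + r"
proof -
  have "even (5 * r\<^sup>2 + r)" by simp
  then show ?thesis unfolding pent_def by simp
qed

lemma pent_0 [simp]: "pent 0 = 0"
  by (simp add: pent_def)

lemma pent_Suc: "pent (Suc r) = pent r + 5 * r + 3"
  using two_pent[of r] two_pent[of "Suc r"] by (simp add: power2_eq_square)

lemma pent_ge: "r \<le> pent r"
  by (induction r) (simp_all add: pent_Suc)

section \<open>The Rogers-Selberg series and the recurrence it shares with the sum side\<close>

context
  fixes q :: complex
  assumes q: "norm q < 1"
begin

definition rs_coeff :: "nat \<Rightarrow> nat \<Rightarrow> complex" where
  "rs_coeff n r = (- 1) ^ r * qpoch q q (n + r) / qpoch q q r"

lemma rs_coeff_Suc: "rs_coeff (Suc n) r = rs_coeff n r * (1 - q ^ (n + 1 + r))"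
  by (simp add: rs_coeff_def qpoch_Suc)

text \<open>A step in \<open>r\<close> is traded for a step in \<open>n\<close> and a sign. Together
  with \<open>rs_coeff_Suc\<close> this rewrites both parts of a split series, after the shift, with
  coefficients at \<open>Suc n\<close>.\<close>

lemma rs_coeff_Suc': "(1 - q ^ Suc r) * rs_coeff n (Suc r) = - rs_coeff (Suc n) r"
  using one_minus_power_nonzero[OF q, of "Suc r"] qpoch_nonzero[OF q, of r]
  by (simp add: rs_coeff_def qpoch_Suc)

lemma rs_coeff_bounded:
  obtains K where "K > 0" "\<And>n r. norm (rs_coeff n r) \<le> K"
proof -
  obtain K where K: "K > 0" "\<And>n. norm (qpoch q q n) \<le> K"
    using qpoch_bounded[OF q] by metis
  obtain L where L: "L > 0" "\<And>n. norm (inverse (qpoch q q n)) \<le> L"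
    using inverse_qpoch_bounded[OF q] by metis
  have "norm (rs_coeff n r) \<le> K * L" for n r
    unfolding rs_coeff_def divide_inverse norm_mult norm_power
    using mult_mono[OF K(2) L(2)] K(1) by (simp add: norm_inverse)
  then show ?thesis using that[of "K * L"] K(1) L(1) by simp
qed

lemma norm_one_minus_power_le: "norm (1 - q ^ m) \<le> 2"
proof -
  have "norm (q ^ m) \<le> 1" using q by (simp add: norm_power power_le_one)
  then show ?thesis using norm_triangle_ineq4[of 1 "q ^ m"] by simp
qed

lemma rs_summable:
  assumes "\<And>r. pent r \<le> e r"
  shows "summable (\<lambda>r. q ^ e r * rs_coeff n r)"
    and "summable (\<lambda>r. q ^ e r * ((1 - q ^ m r) * rs_coeff n r))"
proof -
  obtain K where K: "K > 0" "\<And>n r. norm (rs_coeff n r) \<le> K"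
    using rs_coeff_bounded by blast
  have e: "r \<le> e r" for r using assms pent_ge order_trans by blast
  show "summable (\<lambda>r. q ^ e r * rs_coeff n r)"
    by (rule summable_norm_cancel[OF summable_power_mult_bounded[OF q e K(2)]])
  have "norm ((1 - q ^ m r) * rs_coeff n r) \<le> 2 * K" for r
    unfolding norm_mult using K norm_one_minus_power_le by (intro mult_mono) auto
  then show "summable (\<lambda>r. q ^ e r * ((1 - q ^ m r) * rs_coeff n r))"
    by (rule summable_norm_cancel[OF summable_power_mult_bounded[OF q e]])
qed

text \<open>Up to the factor (q;q)_infinity, \<open>rs1 n\<close> and \<open>rs2 n\<close> are the values at a = q^(n+1) of the two Rogers-Selberg
  series H_1(a) and H_2(a) of Hardy and Wright, section 19.14. At such \<open>a\<close> the product 1/(aq^r;q)_infinity becomes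
  (q;q)_(n+r) / (q;q)_infinity, so only finite products occur.\<close>

definition rs1 :: "nat \<Rightarrow> complex" where
  "rs1 n = (\<Sum>r. q ^ (2 * n * r + r + pent r) * ((1 - q ^ (n + 1 + 2 * r)) * rs_coeff n r))"

definition rs2 :: "nat \<Rightarrow> complex" where
  "rs2 n = (\<Sum>r. q ^ (2 * n * r + pent r) * ((1 - q ^ (2 * n + 2 + 4 * r)) * rs_coeff n r))"

text \<open>Split 1 - q^(n+1+2r) = q^r (1 - q^(n+1+r)) + (1 - q^r). The first part raises
  \<open>n\<close> directly; the second vanishes at r = 0 and raises \<open>n\<close> after a shift
  of \<open>r\<close>.\<close>

lemma rs1_eq_rs2: "rs1 n = rs2 (Suc n)"
proof -
  define X where "X r = q ^ (2 * Suc n * r + pent r) * rs_coeff (Suc n) r" for r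
  define Y where "Y r = q ^ (2 * n * r + r + pent r) * ((1 - q ^ r) * rs_coeff n r)" for r
  have "rs1 n = (\<Sum>r. X r + Y r)"
    unfolding rs1_def X_def Y_def rs_coeff_Suc
    by (intro suminf_cong) (simp add: power_add eval_nat_numeral algebra_simps)
  also have "\<dots> = (\<Sum>r. X r + Y (Suc r))"
    unfolding X_def Y_def by (intro suminf_shift_part rs_summable) auto
  also have "\<dots> = rs2 (Suc n)"
    unfolding rs2_def X_def Y_def rs_coeff_Suc' pent_Suc
    by (intro suminf_cong) (simp add: power_add eval_nat_numeral algebra_simps)
  finally show ?thesis .
qed

text \<open>The same device with (1 - q^(2n+2+4r)) - q^r (1 - q^(n+1+2r)) = q^(n+1+3r) (1 -
  q^(n+1+r)) + (1 - q^r).\<close>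

lemma rs2_diff_rs1: "rs2 n - rs1 n = q ^ Suc n * rs1 (Suc n)"
proof -
  define X where "X r = q ^ (2 * Suc n * r + (n + 1 + r) + pent r) * rs_coeff (Suc n) r" for r
  define Y where "Y r = q ^ (2 * n * r + pent r) * ((1 - q ^ r) * rs_coeff n r)" for r
  have "rs2 n - rs1 n =
    (\<Sum>r. q ^ (2 * n * r + pent r) * ((1 - q ^ (2 * n + 2 + 4 * r)) * rs_coeff n r)
        - q ^ (2 * n * r + r + pent r) * ((1 - q ^ (n + 1 + 2 * r)) * rs_coeff n r))"
    unfolding rs1_def rs2_def by (intro suminf_diff rs_summable) auto
  also have "\<dots> = (\<Sum>r. X r + Y r)"
    unfolding X_def Y_def rs_coeff_Suc
    by (intro suminf_cong) (simp add: power_add eval_nat_numeral algebra_simps)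
  also have "\<dots> = (\<Sum>r. X r + Y (Suc r))"
    unfolding X_def Y_def by (intro suminf_shift_part rs_summable) auto
  also have "\<dots> = (\<Sum>r. q ^ Suc n * (q ^ (2 * Suc n * r + r + pent r)
      * ((1 - q ^ (Suc n + 1 + 2 * r)) * rs_coeff (Suc n) r)))"
    unfolding X_def Y_def rs_coeff_Suc' pent_Suc
    by (intro suminf_cong) (simp add: power_add eval_nat_numeral algebra_simps)
  also have "\<dots> = q ^ Suc n * rs1 (Suc n)"
    unfolding rs1_def by (intro suminf_mult rs_summable) auto
  finally show ?thesis .
qed

text \<open>The power q^(2nr) kills every term with r > 0 as n grows, and the term r = 0 tends to
  the infinite product; the bound by 2K |q|^r is uniform in n.\<close>

lemma rs2_tendsto: "rs2 \<longlonglongrightarrow> qpoch_inf q q"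
proof -
  obtain K where K: "K > 0" "\<And>n r. norm (rs_coeff n r) \<le> K"
    using rs_coeff_bounded by blast
  let ?a = "\<lambda>r n. q ^ (2 * n * r + pent r) * ((1 - q ^ (2 * n + 2 + 4 * r)) * rs_coeff n r)"
  let ?b = "\<lambda>r::nat. if r = 0 then qpoch_inf q q else 0"
  have bound: "norm (?a r n) \<le> norm q ^ r * (2 * K)" for r n
    unfolding norm_mult norm_power
    by (intro mult_mono power_decreasing norm_one_minus_power_le K(2))
       (use K(1) q pent_ge[of r] in auto)
  have lim: "(\<lambda>n. ?a r n) \<longlonglongrightarrow> ?b r" for r
  proof (cases "r = 0")
    case True
    have "filterlim (\<lambda>n::nat. 2 * n + 2) sequentially sequentially"
      by (rule filterlim_at_top_mono[OF filterlim_ident]) (simp add: always_eventually)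
    then have "(\<lambda>n. (1 - q ^ (2 * n + 2)) * qpoch q q n) \<longlonglongrightarrow> (1 - 0) * qpoch_inf q q"
      using q by (intro tendsto_mult tendsto_diff tendsto_const qpoch_tendsto
                    filterlim_compose[OF LIMSEQ_power_zero])
    then show ?thesis using True by (simp add: rs_coeff_def)
  next
    case False
    have "norm (?a r n) \<le> norm q ^ n * (2 * K)" for n
      unfolding norm_mult norm_power
      by (intro mult_mono power_decreasing norm_one_minus_power_le K(2))
         (use K(1) q False in \<open>auto intro!: trans_le_add1\<close>)
    moreover have "(\<lambda>n. norm q ^ n * (2 * K)) \<longlonglongrightarrow> 0 * (2 * K)"
      using q by (intro tendsto_mult tendsto_const LIMSEQ_power_zero) simp
    ultimately have "(\<lambda>n. ?a r n) \<longlonglongrightarrow> 0"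
      by (intro Lim_null_comparison[of "?a r"]) (auto intro: always_eventually)
    then show ?thesis using False by simp
  qed
  have "(\<lambda>n. \<Sum>r. ?a r n) \<longlonglongrightarrow> (\<Sum>r. ?b r)"
  proof (rule tannerys_theorem[THEN conjunct2, THEN conjunct2])
    show "eventually (\<lambda>(r, n). norm (?a r n) \<le> norm q ^ r * (2 * K)) (sequentially \<times>\<^sub>F sequentially)"
      by (rule always_eventually) (simp only: split_beta bound simp_thms)
    show "summable (\<lambda>r. norm q ^ r * (2 * K))"
      using q by (intro summable_mult2 summable_geometric) simp
  qed (rule lim, rule sequentially_bot)
  moreover have "(\<Sum>r. ?b r) = qpoch_inf q q"
    using suminf_finite[of "{0}" ?b] by simp
  ultimately show ?thesis by (simp add: rs2_def[abs_def])
qed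

text \<open>The value at a = q^(n+1) of the series with terms a^k q^(k(k-1)) / (q;q)_k.\<close>

definition rr_series :: "nat \<Rightarrow> complex" where
  "rr_series n = (\<Sum>k. q ^ (n * k + k\<^sup>2) / qpoch q q k)"

lemma rr_term_summable: "summable (\<lambda>k. norm (q ^ (n * k + k\<^sup>2) / qpoch q q k))"
proof -
  obtain L where L: "L > 0" "\<And>n. norm (inverse (qpoch q q n)) \<le> L"
    using inverse_qpoch_bounded[OF q] by metis
  have "k \<le> n * k + k\<^sup>2" for k
    by (simp add: power2_nat_le_imp_le trans_le_add2)
  from summable_power_mult_bounded[OF q this L(2)] show ?thesis
    by (simp only: divide_inverse)
qed

text \<open>In the difference of two consecutive series the factor 1 - q^k cancels the last factor
  of (q;q)_k, and shifting k by one gives the third series.\<close>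

lemma rr_series_rec: "rr_series n = rr_series (Suc n) + q ^ Suc n * rr_series (Suc (Suc n))"
proof -
  note summable = summable_norm_cancel[OF rr_term_summable]
  define Y where "Y k = q ^ (n * k + k\<^sup>2) * (1 - q ^ k) / qpoch q q k" for k
  have Y: "Y k = q ^ (n * k + k\<^sup>2) / qpoch q q k - q ^ (Suc n * k + k\<^sup>2) / qpoch q q k" for k
    by (simp add: Y_def power_add ring_distribs diff_divide_distrib)
  have Y_Suc: "Y (Suc k) = q ^ Suc n * (q ^ (Suc (Suc n) * k + k\<^sup>2) / qpoch q q k)" for k
  proof -
    have "Y (Suc k) = q ^ (n * Suc k + (Suc k)\<^sup>2) / qpoch q q k"
      using one_minus_power_nonzero[OF q, of "Suc k"] by (simp add: Y_def qpoch_Suc)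
    also have "n * Suc k + (Suc k)\<^sup>2 = Suc n + (Suc (Suc n) * k + k\<^sup>2)"
      by (simp add: power2_eq_square)
    finally show ?thesis by (simp only: power_add times_divide_eq_right)
  qed
  have "rr_series n - rr_series (Suc n) = (\<Sum>k. Y k)"
    unfolding rr_series_def Y by (rule suminf_diff[OF summable summable])
  also have "\<dots> = (\<Sum>k. Y (Suc k))"
    using suminf_split_head[of Y] summable_diff[OF summable summable, of n "Suc n"]
    by (simp add: Y[abs_def] del: power_Suc)
  also have "\<dots> = q ^ Suc n * rr_series (Suc (Suc n))"
    unfolding rr_series_def Y_Suc by (rule suminf_mult[OF summable])
  finally show ?thesis by (simp add: algebra_simps)
qed

lemma rr_series_tendsto: "rr_series \<longlonglongrightarrow> 1"
proof -
  obtain L where L: "L > 0" "\<And>n. norm (inverse (qpoch q q n)) \<le> L"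
    using inverse_qpoch_bounded[OF q] by metis
  let ?a = "\<lambda>k n. q ^ (n * k + k\<^sup>2) / qpoch q q k"
  let ?b = "\<lambda>k::nat. if k = 0 then 1 else 0 :: complex"
  have bound: "norm (?a k n) \<le> norm q ^ m * L" if "m \<le> n * k + k\<^sup>2" for k n m
    unfolding divide_inverse norm_mult norm_power
    using L q that by (intro mult_mono power_decreasing) auto
  have lim: "(\<lambda>n. ?a k n) \<longlonglongrightarrow> ?b k" for k
  proof (cases "k = 0")
    case False
    have "norm (?a k n) \<le> norm q ^ n * L" for n
      using False by (intro bound) (simp add: trans_le_add1)
    moreover have "(\<lambda>n. norm q ^ n * L) \<longlonglongrightarrow> 0 * L"
      using q by (intro tendsto_mult tendsto_const LIMSEQ_power_zero) simp
    ultimately have "(\<lambda>n. ?a k n) \<longlonglongrightarrow> 0"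
      by (intro Lim_null_comparison[of "?a k"]) (auto intro: always_eventually)
    then show ?thesis using False by simp
  qed simp
  have "(\<lambda>n. \<Sum>k. ?a k n) \<longlonglongrightarrow> (\<Sum>k. ?b k)"
  proof (rule tannerys_theorem[THEN conjunct2, THEN conjunct2])
    have "k \<le> n * k + k\<^sup>2" for n k :: nat
      by (simp add: power2_nat_le_imp_le trans_le_add2)
    note bound' = bound[OF this]
    show "eventually (\<lambda>(k, n). norm (?a k n) \<le> norm q ^ k * L) (sequentially \<times>\<^sub>F sequentially)"
      by (rule always_eventually) (simp only: split_beta bound' simp_thms)
    show "summable (\<lambda>k. norm q ^ k * L)"
      using q by (intro summable_mult2 summable_geometric) simp
  qed (rule lim, rule sequentially_bot)
  moreover have "(\<Sum>k. ?b k) = 1"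
    using suminf_finite[of "{0}" ?b] by simp
  ultimately show ?thesis by (simp add: rr_series_def[abs_def])
qed

text \<open>Both sides solve the same recurrence and tend to \<open>qpoch_inf q q\<close>, so their
  difference is a solution with limit 0.\<close>

lemma rs2_eq_rr_series: "rs2 n = qpoch_inf q q * rr_series n"
proof -
  have rs2_rec: "rs2 n = rs2 (Suc n) + q ^ Suc n * rs2 (Suc (Suc n))" for n
    using rs2_diff_rs1[of n] by (simp add: rs1_eq_rs2 algebra_simps)
  have "rs2 n - qpoch_inf q q * rr_series n = 0"
  proof (rule power_recurrence_zero[OF q, of "\<lambda>n. rs2 n - qpoch_inf q q * rr_series n"])
    show "rs2 n - qpoch_inf q q * rr_series n = rs2 (Suc n) - qpoch_inf q q * rr_series (Suc n)
        + q ^ Suc n * (rs2 (Suc (Suc n)) - qpoch_inf q q * rr_series (Suc (Suc n)))" for n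
      by (subst rs2_rec, subst rr_series_rec) (simp add: algebra_simps)
    have "(\<lambda>n. rs2 n - qpoch_inf q q * rr_series n) \<longlonglongrightarrow> qpoch_inf q q - qpoch_inf q q * 1"
      by (intro tendsto_diff tendsto_mult tendsto_const rs2_tendsto rr_series_tendsto)
    then show "(\<lambda>n. rs2 n - qpoch_inf q q * rr_series n) \<longlonglongrightarrow> 0" by simp
  qed
  then show ?thesis by simp
qed

section \<open>From Rogers-Selberg series to theta products of modulus 5\<close>

lemma two_tri_nat: "2 * tri (int r) = r * (r + 1)" "2 * tri (- int r) + r = r * r"
  "2 * tri (- 1 - int r) = r * (r + 1)" "2 * tri (1 + int r) = (r + 1) * (r + 2)"
proof -
  show "2 * tri (int r) = r * (r + 1)"
    using int_tri[of "int r"] by (subst of_nat_eq_iff[where 'a = int, symmetric]) (simp add: algebra_simps)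
  show "2 * tri (- int r) + r = r * r"
    using int_tri[of "- int r"] by (subst of_nat_eq_iff[where 'a = int, symmetric]) (simp add: algebra_simps)
  show "2 * tri (- 1 - int r) = r * (r + 1)"
    using int_tri[of "- 1 - int r"] by (subst of_nat_eq_iff[where 'a = int, symmetric]) (simp add: algebra_simps)
  show "2 * tri (1 + int r) = (r + 1) * (r + 2)"
    using int_tri[of "1 + int r"] by (subst of_nat_eq_iff[where 'a = int, symmetric]) (simp add: algebra_simps)
qed

text \<open>The triple product at -q^k and -q^l, with the terms r and -1 - r paired. The sign
  exponents add up to r^2 in one term and (r+1)^2 in the other, so the two terms have opposite
  signs.\<close>

lemma alternating_theta_sums:
  assumes "k > 0" "l > 0"
  shows "(\<lambda>r. (- 1) ^ r * (q ^ (k * tri (int r) + l * tri (- int r))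
                 - q ^ (k * tri (int r) + l * tri (1 + int r)))) sums
    (qpoch_inf (q ^ k) (q ^ (k + l)) * qpoch_inf (q ^ l) (q ^ (k + l)) * qpoch_inf (q ^ (k + l)) (q ^ (k + l)))"
proof -
  have n: "norm (- (q ^ k)) < 1" "norm (- (q ^ l)) < 1"
    using q assms by (simp_all add: norm_power power_less_one_iff)
  have sign: "(- 1) ^ tri (int r) * (- 1) ^ tri (- int r) = ((- 1) ^ r :: complex)"
    "(- 1) ^ tri (int r) * (- 1) ^ tri (1 + int r) = (- ((- 1) ^ r) :: complex)" for r
  proof -
    have s: "tri (int r) + tri (- int r) = r * r"
      using two_tri_nat[of r] by simp
    have "(- 1) ^ tri (int r) * (- 1) ^ tri (- int r) = ((- 1) ^ (r * r) :: complex)"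
      by (simp only: power_add[symmetric] s)
    then show "(- 1) ^ tri (int r) * (- 1) ^ tri (- int r) = ((- 1) ^ r :: complex)"
      by (simp add: uminus_power_if)
    have s: "tri (int r) + tri (1 + int r) = (r + 1) * (r + 1)"
      using two_tri_nat[of r] by simp
    have "(- 1) ^ tri (int r) * (- 1) ^ tri (1 + int r) = ((- 1) ^ ((r + 1) * (r + 1)) :: complex)"
      by (simp only: power_add[symmetric] s)
    then show "(- 1) ^ tri (int r) * (- 1) ^ tri (1 + int r) = (- ((- 1) ^ r) :: complex)"
      by (simp add: uminus_power_if)
  qed
  have tri_neg: "tri (- 1 - int r) = tri (int r)" for r
    using two_tri_nat[of r] by simp
  have "((\<lambda>r. (- (q ^ k)) ^ tri (int r) * (- (q ^ l)) ^ tri (- int r)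
          + (- (q ^ k)) ^ tri (- 1 - int r) * (- (q ^ l)) ^ tri (- (- 1 - int r))) has_sum
    (qpoch_inf (q ^ k) (q ^ (k + l)) * qpoch_inf (q ^ l) (q ^ (k + l)) * qpoch_inf (q ^ (k + l)) (q ^ (k + l)))) UNIV"
    using has_sum_int_fold[OF jacobi_triple_product[OF n]] by (simp add: power_add)
  moreover have "(- (q ^ k)) ^ tri (int r) * (- (q ^ l)) ^ tri (- int r)
          + (- (q ^ k)) ^ tri (- 1 - int r) * (- (q ^ l)) ^ tri (- (- 1 - int r))
     = (- 1) ^ r * (q ^ (k * tri (int r) + l * tri (- int r))
                 - q ^ (k * tri (int r) + l * tri (1 + int r)))" for r
  proof -
    have m: "- (- 1 - int r) = 1 + int r" by simp
    have "(- (q ^ k)) ^ s * (- (q ^ l)) ^ t = ((- 1) ^ s * (- 1) ^ t) * q ^ (k * s + l * t)" for s t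
      by (subst (1 2) power_minus) (simp add: power_add power_mult mult_ac)
    then show ?thesis
      unfolding m tri_neg by (simp only: sign) (simp add: algebra_simps)
  qed
  ultimately show ?thesis
    by (intro has_sum_imp_sums) simp
qed

text \<open>At n = 0 the two q-factorials in \<open>rs_coeff\<close> cancel and leave (-1)^r, so
  \<open>rs2 0\<close> is an alternating theta series. The weights 3 and 2 reproduce its exponents
  \<open>pent r\<close> and \<open>pent r + 4r + 2\<close>.\<close>

theorem rogers_ramanujan_1:
  "((\<lambda>n. q ^ n\<^sup>2 / qpoch q q n) has_sum
      (qpoch_inf (q ^ 3) (q ^ 5) * qpoch_inf (q ^ 2) (q ^ 5) * qpoch_inf (q ^ 5) (q ^ 5) / qpoch_inf q q)) UNIV"
proof -
  have "q ^ (2 * 0 * r + pent r) * ((1 - q ^ (2 * 0 + 2 + 4 * r)) * rs_coeff 0 r)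
      = (- 1) ^ r * (q ^ (3 * tri (int r) + 2 * tri (- int r))
                 - q ^ (3 * tri (int r) + 2 * tri (1 + int r)))" for r
  proof -
    have e: "3 * tri (int r) + 2 * tri (- int r) = pent r"
      "3 * tri (int r) + 2 * tri (1 + int r) = pent r + (2 + 4 * r)"
      using two_tri_nat[of r] two_pent[of r] by (simp_all add: power2_eq_square)
    show ?thesis
      unfolding e using qpoch_nonzero[OF q, of r]
      by (simp add: rs_coeff_def power_add eval_nat_numeral algebra_simps)
  qed
  then have "rs2 0 = qpoch_inf (q ^ 3) (q ^ 5) * qpoch_inf (q ^ 2) (q ^ 5) * qpoch_inf (q ^ 5) (q ^ 5)"
    using alternating_theta_sums[of 3 2] unfolding rs2_def by (simp add: sums_iff)
  then have "rr_series 0 = qpoch_inf (q ^ 3) (q ^ 5) * qpoch_inf (q ^ 2) (q ^ 5) * qpoch_inf (q ^ 5) (q ^ 5) / qpoch_inf q q"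
    using rs2_eq_rr_series[of 0] qpoch_inf_nonzero[OF q q] by (simp add: field_simps)
  then show ?thesis
    using rr_term_summable[of 0] unfolding rr_series_def
    by (intro norm_summable_imp_has_sum) (simp_all add: sums_iff summable_norm_cancel)
qed

text \<open>The left side is \<open>rr_series 1\<close>, and \<open>rs2 1 = rs1 0\<close> brings the
  coefficient back to n = 0. The exponents \<open>r + pent r\<close> and
  \<open>pent r + 3r + 1\<close> call for the weights 4 and 1.\<close>

theorem rogers_ramanujan_2:
  "((\<lambda>n. q ^ (n\<^sup>2 + n) / qpoch q q n) has_sum
      (qpoch_inf (q ^ 4) (q ^ 5) * qpoch_inf q (q ^ 5) * qpoch_inf (q ^ 5) (q ^ 5) / qpoch_inf q q)) UNIV"
proof -
  have "q ^ (2 * 0 * r + r + pent r) * ((1 - q ^ (0 + 1 + 2 * r)) * rs_coeff 0 r)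
      = (- 1) ^ r * (q ^ (4 * tri (int r) + 1 * tri (- int r))
                 - q ^ (4 * tri (int r) + 1 * tri (1 + int r)))" for r
  proof -
    have e: "4 * tri (int r) + 1 * tri (- int r) = r + pent r"
      "4 * tri (int r) + 1 * tri (1 + int r) = r + pent r + (1 + 2 * r)"
      using two_tri_nat[of r] two_pent[of r] by (simp_all add: power2_eq_square)
    show ?thesis
      unfolding e using qpoch_nonzero[OF q, of r]
      by (simp add: rs_coeff_def power_add eval_nat_numeral algebra_simps)
  qed
  then have "rs1 0 = qpoch_inf (q ^ 4) (q ^ 5) * qpoch_inf q (q ^ 5) * qpoch_inf (q ^ 5) (q ^ 5)"
    using alternating_theta_sums[of 4 1] unfolding rs1_def by (simp add: sums_iff)
  then have "rr_series 1 = qpoch_inf (q ^ 4) (q ^ 5) * qpoch_inf q (q ^ 5) * qpoch_inf (q ^ 5) (q ^ 5) / qpoch_inf q q"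
    using rs2_eq_rr_series[of 1] rs1_eq_rs2[of 0] qpoch_inf_nonzero[OF q q] by (simp add: field_simps)
  then show ?thesis
    using rr_term_summable[of 1] unfolding rr_series_def
    by (intro norm_summable_imp_has_sum) (simp_all add: sums_iff summable_norm_cancel add.commute)
qed

end

section \<open>Dissections of theta functions and of double sums\<close>

text \<open>By Euler, the series in x with coefficients 1/(p^2;p^2)_k is 1/(x;p^2)_inf. Its product
  with the same series at px is 1/(x;p)_inf, with coefficients 1/(p;p)_n: p is a square root of the
  base, so the two products interleave.\<close>

lemma sum_inverse_qpoch_products:
  fixes p :: complex
  assumes p: "norm p < 1"
  shows "(\<Sum>j\<le>n. p ^ j / (qpoch (p\<^sup>2) (p\<^sup>2) (n - j) * qpoch (p\<^sup>2) (p\<^sup>2) j)) = 1 / qpoch p p n"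
proof -
  have p2: "norm (p\<^sup>2) < 1"
    using p by (simp add: norm_power power_less_one_iff)
  define B where "B k = inverse (qpoch (p\<^sup>2) (p\<^sup>2) k)" for k
  define c where "c n = (\<Sum>j\<le>n. p ^ j * (B j * B (n - j)))" for n
  have B_Suc: "(1 - (p\<^sup>2) ^ Suc j) * B (Suc j) = B j" for j
    using one_minus_power_nonzero[OF p2, of "Suc j"] by (simp add: B_def qpoch_Suc)
  \<comment> \<open>The generating function A(x) A(px) of \<open>c\<close>, where A(p^2 x) = (1 - x) A(x), satisfies
    f(px) = (1 - x) f(x); this is the recurrence \<open>c_Suc\<close> on coefficients.\<close>
  have c_rev: "c n = (\<Sum>j\<le>n. p ^ (n - j) * (B j * B (n - j)))" for n
    unfolding c_def
    by (rule sum.reindex_bij_witness[of _ "\<lambda>j. n - j" "\<lambda>j. n - j"]) auto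
  have c_Suc: "(1 - p ^ Suc n) * c (Suc n) = c n" for n
  proof -
    have "p ^ Suc n * c (Suc n) = (\<Sum>j\<le>Suc n. p ^ (Suc n - j) * ((p\<^sup>2) ^ j * (B j * B (Suc n - j))))"
      unfolding c_def sum_distrib_left
    proof (rule sum.cong)
      fix j assume "j \<in> {..Suc n}"
      then have "Suc n + j = (Suc n - j) + 2 * j" by simp
      then have "p ^ Suc n * p ^ j = p ^ (Suc n - j) * (p\<^sup>2) ^ j"
        by (metis power_add power_mult)
      then show "p ^ Suc n * (p ^ j * (B j * B (Suc n - j)))
          = p ^ (Suc n - j) * ((p\<^sup>2) ^ j * (B j * B (Suc n - j)))"
        by (simp only: mult.assoc[symmetric])
    qed simp
    then have "(1 - p ^ Suc n) * c (Suc n)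
        = (\<Sum>j\<le>Suc n. p ^ (Suc n - j) * ((1 - (p\<^sup>2) ^ j) * B j) * B (Suc n - j))"
      by (simp only: left_diff_distrib c_rev[of "Suc n"] mult_1 sum_subtractf[symmetric])
         (intro sum.cong refl, simp add: algebra_simps)
    also have "\<dots> = (\<Sum>j\<le>n. p ^ (n - j) * B j * B (n - j))"
      by (simp only: sum.atMost_Suc_shift B_Suc diff_Suc_Suc) simp
    finally show ?thesis by (simp only: c_rev[of n] mult.assoc)
  qed
  have "c n = 1 / qpoch p p n"
  proof (induction n)
    case (Suc n)
    have "c (Suc n) = c n / (1 - p ^ Suc n)"
      using c_Suc[of n] one_minus_power_nonzero[OF p, of "Suc n"] by (simp add: eq_divide_eq mult.commute)
    then show ?case
      by (simp add: Suc qpoch_Suc)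
  qed (simp add: c_def B_def)
  then show ?thesis
    by (simp add: c_def B_def divide_inverse mult_ac)
qed

lemma geometric_product_summable:
  fixes x :: real
  assumes "0 \<le> x" "x < 1"
  shows "(\<lambda>(i, j). x ^ i * x ^ j) summable_on (UNIV :: (nat \<times> nat) set)"
proof -
  have 1: "((\<lambda>n. x ^ n) has_sum (1 / (1 - x))) UNIV"
    using assms geometric_sums[of x] by (intro norm_summable_imp_has_sum) (auto simp: summable_geometric)
  have "(\<lambda>(i, j). x ^ i * x ^ j) summable_on (SIGMA i:(UNIV::nat set). (UNIV::nat set))"
  proof (rule summable_on_SigmaI)
    show "((\<lambda>j. case (i, j) of (i, j) \<Rightarrow> x ^ i * x ^ j) has_sum x ^ i * (1 / (1 - x))) UNIV" for i
      unfolding prod.case by (rule has_sum_cmult_right[OF 1])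
    show "(\<lambda>i. x ^ i * (1 / (1 - x))) summable_on UNIV"
      by (rule summable_on_cmult_left[OF has_sum_imp_summable[OF 1]])
  qed (use assms in auto)
  then show ?thesis by simp
qed

text \<open>Summed along i + j = n, the double series has finite inner sums evaluated by
  \<open>sum_inverse_qpoch_products\<close>. Absolute summability justifies the return from iterated
  to unconditional sum. The exponent \<open>e\<close> is left open so that n^2 and n^2 + n are both
  covered.\<close>

lemma has_sum_antidiagonals:
  fixes p :: complex
  assumes p: "norm p < 1" and e: "\<And>n. n \<le> e n"
    and S: "((\<lambda>n. p ^ e n / qpoch p p n) has_sum S) UNIV"
  shows "((\<lambda>(i, j). p ^ (e (i + j) + j) / (qpoch (p\<^sup>2) (p\<^sup>2) i * qpoch (p\<^sup>2) (p\<^sup>2) j)) has_sum S) UNIV"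
    (is "(?T has_sum S) UNIV")
proof -
  have p2: "norm (p\<^sup>2) < 1"
    using p by (simp add: norm_power power_less_one_iff)
  obtain L where L: "L > 0" "\<And>n. norm (inverse (qpoch (p\<^sup>2) (p\<^sup>2) n)) \<le> L"
    using inverse_qpoch_bounded[OF p2] by metis
  have "(\<lambda>z. (case z of (i, j) \<Rightarrow> norm p ^ i * norm p ^ j) * (L * L)) summable_on (UNIV :: (nat \<times> nat) set)"
    using p by (intro summable_on_cmult_left geometric_product_summable) auto
  then have "(\<lambda>z. norm (?T z)) summable_on UNIV"
  proof (rule Infinite_Sum.abs_summable_on_comparison_test')
    fix z :: "nat \<times> nat"
    obtain i j where z: "z = (i, j)" by (cases z)
    have "i + j \<le> e (i + j) + j" using e[of "i + j"] by simp
    then have "norm p ^ (e (i + j) + j) * (norm (inverse (qpoch (p\<^sup>2) (p\<^sup>2) i)) * norm (inverse (qpoch (p\<^sup>2) (p\<^sup>2) j)))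
        \<le> norm p ^ (i + j) * (L * L)"
      using p L by (intro mult_mono power_decreasing) auto
    then show "norm (?T z) \<le> (case z of (i, j) \<Rightarrow> norm p ^ i * norm p ^ j) * (L * L)"
      by (simp add: z norm_mult norm_power norm_divide norm_inverse power_add divide_inverse inverse_mult_distrib)
  qed
  then have summ: "?T summable_on UNIV"
    by (rule abs_summable_summable)
  define h :: "nat \<times> nat \<Rightarrow> nat \<times> nat" where "h = (\<lambda>(n, j). (n - j, j))"
  have h: "bij_betw h (SIGMA n:UNIV. {..n}) UNIV"
    by (rule bij_betw_byWitness[where f' = "\<lambda>(i, j). (i + j, j)"]) (auto simp: h_def)
  have "((\<lambda>z. ?T (h z)) has_sum S) (SIGMA n:UNIV. {..n})"
  proof (rule has_sum_SigmaI[OF _ S])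
    show "(\<lambda>z. ?T (h z)) summable_on (SIGMA n:UNIV. {..n})"
      using summ by (simp only: summable_on_reindex_bij_betw[OF h])
    show "((\<lambda>j. ?T (h (n, j))) has_sum p ^ e n / qpoch p p n) {..n}" for n
    proof (rule has_sum_finiteI)
      have "p ^ e n / qpoch p p n
        = p ^ e n * (\<Sum>j\<le>n. p ^ j / (qpoch (p\<^sup>2) (p\<^sup>2) (n - j) * qpoch (p\<^sup>2) (p\<^sup>2) j))"
        by (simp add: sum_inverse_qpoch_products[OF p])
      also have "\<dots> = (\<Sum>j\<le>n. ?T (h (n, j)))"
        unfolding sum_distrib_left by (intro sum.cong) (auto simp: h_def power_add)
      finally show "p ^ e n / qpoch p p n = (\<Sum>j\<le>n. ?T (h (n, j)))" .
    qed simp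
  qed
  then show ?thesis
    by (simp only: has_sum_reindex_bij_betw[OF h])
qed

text \<open>The weights (1 + (-1)^m)/2 and (1 - (-1)^m)/2 are the indicators of even and odd
  m.\<close>

lemma has_sum_parity_split:
  fixes f :: "nat \<times> nat \<Rightarrow> complex"
  assumes A: "(f has_sum A) UNIV"
    and B: "((\<lambda>(m, j). (- 1) ^ m * f (m, j)) has_sum B) UNIV"
  shows "((\<lambda>(i, j). f (2 * i, j)) has_sum ((A + B) / 2)) UNIV"
    and "((\<lambda>(i, j). f (2 * i + 1, j)) has_sum ((A - B) / 2)) UNIV"
proof -
  have img: "range (\<lambda>(i::nat, j::nat). (2 * i, j)) = {z. even (fst z)}"
      "range (\<lambda>(i::nat, j::nat). (2 * i + 1, j)) = {z. odd (fst z)}"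
    by (auto simp: image_iff elim!: evenE oddE) presburger
  have "((\<lambda>z. (f z + (case z of (m, j) \<Rightarrow> (- 1) ^ m * f (m, j))) * (1 / 2)) has_sum (A + B) * (1 / 2)) UNIV"
    by (intro has_sum_cmult_left has_sum_add A B)
  also have "?this \<longleftrightarrow> (f has_sum (A + B) * (1 / 2)) (range (\<lambda>(i::nat, j::nat). (2 * i, j)))"
    unfolding img by (rule has_sum_cong_neutral) auto
  also have "\<dots> \<longleftrightarrow> ((f \<circ> (\<lambda>(i, j). (2 * i, j))) has_sum (A + B) * (1 / 2)) UNIV"
    by (rule has_sum_reindex) (auto simp: inj_on_def)
  finally show "((\<lambda>(i, j). f (2 * i, j)) has_sum ((A + B) / 2)) UNIV"
    by (simp add: o_def split_def)
  have "((\<lambda>z. (f z + - (case z of (m, j) \<Rightarrow> (- 1) ^ m * f (m, j))) * (1 / 2)) has_sum (A + - B) * (1 / 2)) UNIV"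
    by (intro has_sum_cmult_left has_sum_add A has_sum_uminusI B)
  also have "?this \<longleftrightarrow> (f has_sum (A + - B) * (1 / 2)) (range (\<lambda>(i::nat, j::nat). (2 * i + 1, j)))"
    unfolding img by (rule has_sum_cong_neutral) auto
  also have "\<dots> \<longleftrightarrow> ((f \<circ> (\<lambda>(i, j). (2 * i + 1, j))) has_sum (A + - B) * (1 / 2)) UNIV"
    by (rule has_sum_reindex) (auto simp: inj_on_def)
  finally show "((\<lambda>(i, j). f (2 * i + 1, j)) has_sum ((A - B) / 2)) UNIV"
    by (simp add: o_def split_def)
qed

text \<open>Ramanujan's f(a, b) in product form; \<open>jacobi_triple_product\<close> supplies its
  series.\<close>

definition theta :: "complex \<Rightarrow> complex \<Rightarrow> complex" where
  "theta a b = qpoch_inf (- a) (a * b) * qpoch_inf (- b) (a * b) * qpoch_inf (a * b) (a * b)"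

lemma norm_mult_less_one:
  fixes a b :: "'a :: real_normed_div_algebra"
  shows "norm a < 1 \<Longrightarrow> norm b < 1 \<Longrightarrow> norm (a * b) < 1"
  by (metis mult_strict_mono' mult_1 norm_ge_zero norm_mult)

lemma norm_power_less_one:
  fixes a :: "'a :: real_normed_div_algebra"
  shows "norm a < 1 \<Longrightarrow> n > 0 \<Longrightarrow> norm (a ^ n) < 1"
  by (simp add: norm_power power_less_one_iff)

text \<open>Ramanujan's f(a,b) = f(a^3 b, a b^3) + a f(b/a, a^5 b^3), the split into even and odd j,
  with b = ac so that the quotient b/a becomes the parameter \<open>c\<close>.\<close>

lemma theta_dissect:
  fixes a c :: complex
  assumes a: "norm a < 1" and c: "norm c < 1"
  shows "theta a (a * c) = theta (a ^ 4 * c) (a ^ 4 * c ^ 3) + a * theta (a ^ 8 * c ^ 3) c"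
proof -
  let ?f = "\<lambda>j. a ^ tri j * (a * c) ^ tri (- j)"
  note less = norm_mult_less_one norm_power_less_one a c
  have ev: "?f (2 * k) = (a ^ 4 * c) ^ tri k * (a ^ 4 * c ^ 3) ^ tri (- k)" for k
  proof -
    have 1: "tri (2 * k) + tri (- (2 * k)) = 4 * (tri k + tri (- k))"
      and 2: "tri (- (2 * k)) = tri k + 3 * tri (- k)"
      using int_tri[of "2 * k"] int_tri[of "- (2 * k)"] int_tri[of k] int_tri[of "- k"]
      by (simp_all add: algebra_simps)
    have "?f (2 * k) = a ^ (tri (2 * k) + tri (- (2 * k))) * c ^ tri (- (2 * k))"
      by (simp add: power_add power_mult_distrib mult_ac)
    also have "\<dots> = a ^ (4 * (tri k + tri (- k))) * c ^ (tri k + 3 * tri (- k))"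
      unfolding 1 unfolding 2 ..
    finally show ?thesis
      by (simp add: power_add power_mult_distrib add_mult_distrib2 mult_ac flip: power_mult)
  qed
  have od: "?f (2 * k + 1) = a * ((a ^ 8 * c ^ 3) ^ tri k * c ^ tri (- k))" for k
  proof -
    have 1: "tri (2 * k + 1) + tri (- (2 * k + 1)) = 1 + 8 * tri k"
      and 2: "tri (- (2 * k + 1)) = 3 * tri k + tri (- k)"
      using int_tri[of "2 * k + 1"] int_tri[of "- (2 * k + 1)"] int_tri[of k] int_tri[of "- k"]
      by (simp_all add: algebra_simps)
    have "?f (2 * k + 1) = a ^ (tri (2 * k + 1) + tri (- (2 * k + 1))) * c ^ tri (- (2 * k + 1))"
      by (simp add: power_add power_mult_distrib mult_ac)
    also have "\<dots> = a ^ (1 + 8 * tri k) * c ^ (3 * tri k + tri (- k))"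
      unfolding 1 unfolding 2 ..
    finally show ?thesis
      by (simp add: power_add power_mult_distrib add_mult_distrib2 mult_ac flip: power_mult)
  qed
  have img: "range (\<lambda>k::int. 2 * k) = {j. even j}" "range (\<lambda>k::int. 2 * k + 1) = {j. odd j}"
    by (auto simp: image_iff elim!: evenE oddE) presburger
  have 1: "(?f has_sum theta (a ^ 4 * c) (a ^ 4 * c ^ 3)) (range (\<lambda>k. 2 * k))"
  proof (rule iffD2[OF has_sum_reindex])
    show "(?f \<circ> (\<lambda>k. 2 * k) has_sum theta (a ^ 4 * c) (a ^ 4 * c ^ 3)) UNIV"
      unfolding o_def ev theta_def by (intro jacobi_triple_product less) simp_all
  qed (simp add: inj_on_def)
  have 2: "(?f has_sum a * theta (a ^ 8 * c ^ 3) c) (range (\<lambda>k. 2 * k + 1))"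
  proof (rule iffD2[OF has_sum_reindex])
    show "(?f \<circ> (\<lambda>k. 2 * k + 1) has_sum a * theta (a ^ 8 * c ^ 3) c) UNIV"
      unfolding o_def od theta_def by (intro has_sum_cmult_right jacobi_triple_product less) simp_all
  qed (simp add: inj_on_def)
  have "range (\<lambda>k::int. 2 * k) \<inter> range (\<lambda>k. 2 * k + 1) = {}"
    unfolding img by auto
  note sum = has_sum_Un_disjoint[OF 1 2 this]
  have U: "{j::int. even j} \<union> {j. odd j} = UNIV" by auto
  have "(?f has_sum (theta (a ^ 4 * c) (a ^ 4 * c ^ 3) + a * theta (a ^ 8 * c ^ 3) c)) UNIV"
    using sum unfolding img U .
  moreover have "(?f has_sum theta a (a * c)) UNIV"
    unfolding theta_def by (intro jacobi_triple_product less)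
  ultimately show ?thesis
    using has_sum_unique by blast
qed

section \<open>Infinite products in the bases q^5, q^10, q^20 and q^40\<close>

lemma qpoch_inf_power_dissect2:
  assumes "norm q < 1" "l > 0"
  shows "qpoch_inf (q ^ k) (q ^ l) = qpoch_inf (q ^ k) (q ^ (2 * l)) * qpoch_inf (q ^ (k + l)) (q ^ (2 * l))"
  using qpoch_inf_dissect[OF norm_power_less_one[OF assms], of 2 "q ^ k"]
  by (simp add: numeral_2_eq_2 power_add mult_ac flip: power_mult)

lemma qpoch_inf_power_mult_neg:
  assumes "norm q < 1" "l > 0"
  shows "qpoch_inf (q ^ k) (q ^ l) * qpoch_inf (- (q ^ k)) (q ^ l) = qpoch_inf (q ^ (2 * k)) (q ^ (2 * l))"
  using qpoch_inf_mult_neg[OF norm_power_less_one[OF assms], of "q ^ k"]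
  by (simp add: mult_ac flip: power_mult)

lemma qpoch_inf_dissect5:
  assumes "norm q < 1"
  shows "qpoch_inf q q = qpoch_inf q (q ^ 5) * qpoch_inf (q ^ 2) (q ^ 5) * qpoch_inf (q ^ 3) (q ^ 5)
    * qpoch_inf (q ^ 4) (q ^ 5) * qpoch_inf (q ^ 5) (q ^ 5)"
proof -
  have "{..<5} = {0, 1, 2, 3, 4 :: nat}" by auto
  then show ?thesis
    using qpoch_inf_dissect[OF assms, of 5 q] by (simp add: mult_ac eval_nat_numeral)
qed

lemma qpoch_inf_power_nonzero:
  "norm q < 1 \<Longrightarrow> k > 0 \<Longrightarrow> l > 0 \<Longrightarrow> qpoch_inf (q ^ k) (q ^ l) \<noteq> 0"
  by (intro qpoch_inf_nonzero norm_power_less_one)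

lemma divide_eq_divide_mult:
  fixes t d e n :: "'a :: field"
  shows "e * t = n \<Longrightarrow> e \<noteq> 0 \<Longrightarrow> t / d = n / (d * e)"
  by (auto simp: field_simps)

lemma theta_power:
  "theta (q ^ k) (q ^ l) = qpoch_inf (- (q ^ k)) (q ^ (k + l)) * qpoch_inf (- (q ^ l)) (q ^ (k + l))
     * qpoch_inf (q ^ (k + l)) (q ^ (k + l))"
  by (simp add: theta_def power_add)

text \<open>(q;q)_inf without the factors (q^4, q^6; q^10)_inf; \<open>rr_denom2\<close> likewise
  leaves out (q^2, q^8; q^10)_inf. At q = p^2 these are the denominators that turn f(p, p^9) and
  f(p^3, p^7) into G(p) and H(p).\<close>

definition rr_denom1 :: "complex \<Rightarrow> complex" where
  "rr_denom1 q = qpoch_inf q (q ^ 10) * qpoch_inf (q ^ 9) (q ^ 10)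
     * (qpoch_inf (q ^ 2) (q ^ 5) * qpoch_inf (q ^ 3) (q ^ 5) * qpoch_inf (q ^ 5) (q ^ 5))"

definition rr_denom2 :: "complex \<Rightarrow> complex" where
  "rr_denom2 q = qpoch_inf (q ^ 3) (q ^ 10) * qpoch_inf (q ^ 7) (q ^ 10)
     * (qpoch_inf q (q ^ 5) * qpoch_inf (q ^ 4) (q ^ 5) * qpoch_inf (q ^ 5) (q ^ 5))"

context
  fixes q :: complex
  assumes q: "norm q < 1"
begin

lemmas dissect2 = qpoch_inf_power_dissect2[OF q]
lemmas mult_neg = qpoch_inf_power_mult_neg[OF q]
lemmas nonzero = qpoch_inf_power_nonzero[OF q]

lemma qpoch_inf_eq_rr_denom1:
  "qpoch_inf q q = rr_denom1 q * (qpoch_inf (q ^ 4) (q ^ 10) * qpoch_inf (q ^ 6) (q ^ 10))"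
  using dissect2[of 5 1] dissect2[of 5 4]
  by (simp add: qpoch_inf_dissect5[OF q] rr_denom1_def mult_ac)

lemma qpoch_inf_eq_rr_denom2:
  "qpoch_inf q q = rr_denom2 q * (qpoch_inf (q ^ 2) (q ^ 10) * qpoch_inf (q ^ 8) (q ^ 10))"
  using dissect2[of 5 2] dissect2[of 5 3]
  by (simp add: qpoch_inf_dissect5[OF q] rr_denom2_def mult_ac)

text \<open>The missing factors (q^4, q^6; q^10)_inf restore (q;q)_inf below. Above, they split in
  base q^20 into the parameters q^4, q^14, q^6, q^16; two of these meet their negatives in the theta
  product and give the base q^40, the other two remain.\<close>

lemma theta_div_rr_denom1:
  "theta (q ^ 6) (q ^ 14) / rr_denom1 q
     = qpochs_inf [q ^ 4, q ^ 16, q ^ 20] (q ^ 20) * qpochs_inf [q ^ 12, q ^ 28] (q ^ 40) / qpoch_inf q q"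
  "theta (q ^ 4) (q ^ 16) / rr_denom1 q
     = qpochs_inf [q ^ 6, q ^ 14, q ^ 20] (q ^ 20) * qpochs_inf [q ^ 8, q ^ 32] (q ^ 40) / qpoch_inf q q"
proof -
  let ?E = "qpoch_inf (q ^ 4) (q ^ 10) * qpoch_inf (q ^ 6) (q ^ 10)"
  have E: "?E \<noteq> 0" by (simp add: nonzero)
  have "?E * theta (q ^ 6) (q ^ 14) =
    qpochs_inf [q ^ 4, q ^ 16, q ^ 20] (q ^ 20) * qpochs_inf [q ^ 12, q ^ 28] (q ^ 40)"
    using dissect2[of 10 4] dissect2[of 10 6]
    by (simp add: theta_power qpochs_inf_def mult_neg[of 20 6, simplified, symmetric]
          mult_neg[of 20 14, simplified, symmetric] mult_ac)
  then show "theta (q ^ 6) (q ^ 14) / rr_denom1 q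
     = qpochs_inf [q ^ 4, q ^ 16, q ^ 20] (q ^ 20) * qpochs_inf [q ^ 12, q ^ 28] (q ^ 40) / qpoch_inf q q"
    unfolding qpoch_inf_eq_rr_denom1 using E by (rule divide_eq_divide_mult)
  have "?E * theta (q ^ 4) (q ^ 16) =
    qpochs_inf [q ^ 6, q ^ 14, q ^ 20] (q ^ 20) * qpochs_inf [q ^ 8, q ^ 32] (q ^ 40)"
    using dissect2[of 10 4] dissect2[of 10 6]
    by (simp add: theta_power qpochs_inf_def mult_neg[of 20 4, simplified, symmetric]
          mult_neg[of 20 16, simplified, symmetric] mult_ac)
  then show "theta (q ^ 4) (q ^ 16) / rr_denom1 q
     = qpochs_inf [q ^ 6, q ^ 14, q ^ 20] (q ^ 20) * qpochs_inf [q ^ 8, q ^ 32] (q ^ 40) / qpoch_inf q q"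
    unfolding qpoch_inf_eq_rr_denom1 using E by (rule divide_eq_divide_mult)
qed

lemma theta_div_rr_denom2:
  "theta (q ^ 8) (q ^ 12) / rr_denom2 q
     = qpochs_inf [q ^ 2, q ^ 18, q ^ 20] (q ^ 20) * qpochs_inf [q ^ 16, q ^ 24] (q ^ 40) / qpoch_inf q q"
  "theta (q ^ 2) (q ^ 18) / rr_denom2 q
     = qpochs_inf [q ^ 8, q ^ 12, q ^ 20] (q ^ 20) * qpochs_inf [q ^ 4, q ^ 36] (q ^ 40) / qpoch_inf q q"
proof -
  let ?E = "qpoch_inf (q ^ 2) (q ^ 10) * qpoch_inf (q ^ 8) (q ^ 10)"
  have E: "?E \<noteq> 0" by (simp add: nonzero)
  have "?E * theta (q ^ 8) (q ^ 12) =
    qpochs_inf [q ^ 2, q ^ 18, q ^ 20] (q ^ 20) * qpochs_inf [q ^ 16, q ^ 24] (q ^ 40)"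
    using dissect2[of 10 2] dissect2[of 10 8]
    by (simp add: theta_power qpochs_inf_def mult_neg[of 20 8, simplified, symmetric]
          mult_neg[of 20 12, simplified, symmetric] mult_ac)
  then show "theta (q ^ 8) (q ^ 12) / rr_denom2 q
     = qpochs_inf [q ^ 2, q ^ 18, q ^ 20] (q ^ 20) * qpochs_inf [q ^ 16, q ^ 24] (q ^ 40) / qpoch_inf q q"
    unfolding qpoch_inf_eq_rr_denom2 using E by (rule divide_eq_divide_mult)
  have "?E * theta (q ^ 2) (q ^ 18) =
    qpochs_inf [q ^ 8, q ^ 12, q ^ 20] (q ^ 20) * qpochs_inf [q ^ 4, q ^ 36] (q ^ 40)"
    using dissect2[of 10 2] dissect2[of 10 8]
    by (simp add: theta_power qpochs_inf_def mult_neg[of 20 2, simplified, symmetric]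
          mult_neg[of 20 18, simplified, symmetric] mult_ac)
  then show "theta (q ^ 2) (q ^ 18) / rr_denom2 q
     = qpochs_inf [q ^ 8, q ^ 12, q ^ 20] (q ^ 20) * qpochs_inf [q ^ 4, q ^ 36] (q ^ 40) / qpoch_inf q q"
    unfolding qpoch_inf_eq_rr_denom2 using E by (rule divide_eq_divide_mult)
qed

lemma rogers_ramanujan_1_theta:
  "((\<lambda>n. q ^ n\<^sup>2 / qpoch q q n) has_sum (theta q (q ^ 9) / rr_denom1 (q\<^sup>2))) UNIV"
proof -
  have d: "rr_denom1 (q\<^sup>2) = qpoch_inf (q ^ 2) (q ^ 20) * qpoch_inf (q ^ 18) (q ^ 20)
     * (qpoch_inf (q ^ 4) (q ^ 10) * qpoch_inf (q ^ 6) (q ^ 10) * qpoch_inf (q ^ 10) (q ^ 10))"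
    by (simp add: rr_denom1_def flip: power_mult)
  have "theta q (q ^ 9) * qpoch_inf q q
      = qpoch_inf (q ^ 3) (q ^ 5) * qpoch_inf (q ^ 2) (q ^ 5) * qpoch_inf (q ^ 5) (q ^ 5) * rr_denom1 (q\<^sup>2)"
    using dissect2[of 5 1] dissect2[of 5 4] mult_neg[of 10 1] mult_neg[of 10 9] theta_power[of q 1 9]
    unfolding d qpoch_inf_dissect5[OF q] by (simp add: mult_ac)
  then have "theta q (q ^ 9) / rr_denom1 (q\<^sup>2)
      = qpoch_inf (q ^ 3) (q ^ 5) * qpoch_inf (q ^ 2) (q ^ 5) * qpoch_inf (q ^ 5) (q ^ 5) / qpoch_inf q q"
    using nonzero[of 1 1] by (subst frac_eq_eq) (simp_all add: d nonzero)
  then show ?thesis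
    using rogers_ramanujan_1[OF q] by simp
qed

lemma rogers_ramanujan_2_theta:
  "((\<lambda>n. q ^ (n\<^sup>2 + n) / qpoch q q n) has_sum (theta (q ^ 3) (q ^ 7) / rr_denom2 (q\<^sup>2))) UNIV"
proof -
  have d: "rr_denom2 (q\<^sup>2) = qpoch_inf (q ^ 6) (q ^ 20) * qpoch_inf (q ^ 14) (q ^ 20)
     * (qpoch_inf (q ^ 2) (q ^ 10) * qpoch_inf (q ^ 8) (q ^ 10) * qpoch_inf (q ^ 10) (q ^ 10))"
    by (simp add: rr_denom2_def flip: power_mult)
  have "theta (q ^ 3) (q ^ 7) * qpoch_inf q q
      = qpoch_inf (q ^ 4) (q ^ 5) * qpoch_inf q (q ^ 5) * qpoch_inf (q ^ 5) (q ^ 5) * rr_denom2 (q\<^sup>2)"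
    using dissect2[of 5 2] dissect2[of 5 3] mult_neg[of 10 3] mult_neg[of 10 7] theta_power[of q 3 7]
    unfolding d qpoch_inf_dissect5[OF q] by (simp add: mult_ac)
  then have "theta (q ^ 3) (q ^ 7) / rr_denom2 (q\<^sup>2)
      = qpoch_inf (q ^ 4) (q ^ 5) * qpoch_inf q (q ^ 5) * qpoch_inf (q ^ 5) (q ^ 5) / qpoch_inf q q"
    using nonzero[of 1 1] by (subst frac_eq_eq) (simp_all add: d nonzero)
  then show ?thesis
    using rogers_ramanujan_2[OF q] by simp
qed

end

section \<open>The four double sums\<close>

text \<open>The constants 1 and 3 are the odd powers p and p^3 that later leave the sums over odd m;
  what remains is an even exponent, hence a power of q.\<close>

lemma parity_exponents:
  fixes i j :: nat
  shows "(2 * i + j)\<^sup>2 + j = 2 * (2 * i\<^sup>2 + 2 * i * j + (j\<^sup>2 + j) div 2)"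
    and "(2 * i + 1 + j)\<^sup>2 + j = 1 + 2 * (2 * i\<^sup>2 + 2 * i * j + 2 * i + (j\<^sup>2 + 3 * j) div 2)"
    and "(j + 2 * i)\<^sup>2 + (j + 2 * i) + 2 * i = 2 * (2 * i\<^sup>2 + 2 * i * j + 2 * i + (j\<^sup>2 + j) div 2)"
    and "(j + (2 * i + 1))\<^sup>2 + (j + (2 * i + 1)) + (2 * i + 1)
           = 3 + 2 * (2 * i\<^sup>2 + 2 * i * j + 4 * i + (j\<^sup>2 + 3 * j) div 2)"
proof -
  have 1: "2 * ((j\<^sup>2 + j) div 2) = j\<^sup>2 + j" and 2: "2 * ((j\<^sup>2 + 3 * j) div 2) = j\<^sup>2 + 3 * j"
    by simp_all
  show "(2 * i + j)\<^sup>2 + j = 2 * (2 * i\<^sup>2 + 2 * i * j + (j\<^sup>2 + j) div 2)"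
    unfolding add_mult_distrib2 1 by (simp add: power2_eq_square algebra_simps)
  show "(2 * i + 1 + j)\<^sup>2 + j = 1 + 2 * (2 * i\<^sup>2 + 2 * i * j + 2 * i + (j\<^sup>2 + 3 * j) div 2)"
    unfolding add_mult_distrib2 2 by (simp add: power2_eq_square algebra_simps)
  show "(j + 2 * i)\<^sup>2 + (j + 2 * i) + 2 * i = 2 * (2 * i\<^sup>2 + 2 * i * j + 2 * i + (j\<^sup>2 + j) div 2)"
    unfolding add_mult_distrib2 1 by (simp add: power2_eq_square algebra_simps)
  show "(j + (2 * i + 1))\<^sup>2 + (j + (2 * i + 1)) + (2 * i + 1)
           = 3 + 2 * (2 * i\<^sup>2 + 2 * i * j + 4 * i + (j\<^sup>2 + 3 * j) div 2)"
    unfolding add_mult_distrib2 2 by (simp add: power2_eq_square algebra_simps)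
qed

text \<open>The theta values \<open>?A\<close> and \<open>?B\<close> depend on q only, so one
  dissection serves both roots a = p and a = -p; half the sum and half the difference of the two
  evaluations isolate \<open>?A\<close> and \<open>p * ?B\<close>.\<close>

lemma parity_sums_1:
  fixes p q :: complex
  assumes p: "norm p < 1" and q: "q = p\<^sup>2" and "p \<noteq> 0"
  shows "((\<lambda>(i, j). q ^ (2 * i\<^sup>2 + 2 * i * j + (j\<^sup>2 + j) div 2) / (qpoch q q (2 * i) * qpoch q q j))
            has_sum (theta (q ^ 6) (q ^ 14) / rr_denom1 q)) UNIV"
    and "((\<lambda>(i, j). q ^ (2 * i\<^sup>2 + 2 * i * j + 2 * i + (j\<^sup>2 + 3 * j) div 2)
              / (qpoch q q (2 * i + 1) * qpoch q q j))
            has_sum (theta (q ^ 4) (q ^ 16) / rr_denom1 q)) UNIV"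
proof -
  define f where "f = (\<lambda>(i, j). p ^ ((i + j)\<^sup>2 + j) / (qpoch q q i * qpoch q q j))"
  let ?A = "theta (q ^ 6) (q ^ 14)" and ?B = "theta (q ^ 4) (q ^ 16)"
  \<comment> \<open>Here c = a^8, and the four new arguments a^12, a^28, a^32, a^8 are q^6, q^14,
    q^16, q^4.\<close>
  have dissect: "theta a (a ^ 9) = ?A + a * ?B" if "norm a < 1" "a\<^sup>2 = q" for a
  proof -
    have "theta a (a * a ^ 8) = theta (a ^ 4 * a ^ 8) (a ^ 4 * (a ^ 8) ^ 3) + a * theta (a ^ 8 * (a ^ 8) ^ 3) (a ^ 8)"
      by (rule theta_dissect) (use that in \<open>auto intro: norm_power_less_one\<close>)
    moreover have "theta (q ^ 16) (q ^ 4) = ?B"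
      by (simp add: theta_def mult_ac)
    ultimately show ?thesis
      by (simp add: that(2)[symmetric] flip: power_mult power_add power_Suc)
  qed
  have sum: "((\<lambda>(i, j). a ^ ((i + j)\<^sup>2 + j) / (qpoch q q i * qpoch q q j)) has_sum
                ((?A + a * ?B) / rr_denom1 q)) UNIV" if a: "norm a < 1" "a\<^sup>2 = q" for a
    using has_sum_antidiagonals[OF a(1) _ rogers_ramanujan_1_theta[OF a(1)]]
    unfolding a(2) dissect[OF a] by (simp add: power2_nat_le_imp_le)
  have "(f has_sum (?A + p * ?B) / rr_denom1 q) UNIV"
    unfolding f_def using p q by (intro sum) auto
  moreover have "((\<lambda>(m, j). (- 1) ^ m * f (m, j)) has_sum (?A + - p * ?B) / rr_denom1 q) UNIV"
  proof -
    have "(- p) ^ ((m + j)\<^sup>2 + j) = (- 1) ^ m * p ^ ((m + j)\<^sup>2 + j)" for m j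
    proof -
      have "even ((m + j)\<^sup>2 + j) \<longleftrightarrow> even m" by auto
      then show ?thesis by (simp add: uminus_power_if)
    qed
    then have "(\<lambda>(m, j). (- 1) ^ m * f (m, j)) = (\<lambda>(i, j). (- p) ^ ((i + j)\<^sup>2 + j) / (qpoch q q i * qpoch q q j))"
      by (simp add: f_def)
    then show ?thesis
      using sum[of "- p"] p q by simp
  qed
  ultimately have ev: "((\<lambda>(i, j). f (2 * i, j)) has_sum
        ((?A + p * ?B) / rr_denom1 q + (?A + - p * ?B) / rr_denom1 q) / 2) UNIV"
    and od: "((\<lambda>(i, j). f (2 * i + 1, j)) has_sum
        ((?A + p * ?B) / rr_denom1 q - (?A + - p * ?B) / rr_denom1 q) / 2) UNIV"
    by (rule has_sum_parity_split)+
  have "f (2 * i, j) = q ^ (2 * i\<^sup>2 + 2 * i * j + (j\<^sup>2 + j) div 2) / (qpoch q q (2 * i) * qpoch q q j)" for i j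
    unfolding f_def prod.case parity_exponents by (simp only: power_mult q)
  then show "((\<lambda>(i, j). q ^ (2 * i\<^sup>2 + 2 * i * j + (j\<^sup>2 + j) div 2) / (qpoch q q (2 * i) * qpoch q q j))
            has_sum (theta (q ^ 6) (q ^ 14) / rr_denom1 q)) UNIV"
    using ev by (simp add: add_divide_distrib diff_divide_distrib)
  have "f (2 * i + 1, j) = p * (q ^ (2 * i\<^sup>2 + 2 * i * j + 2 * i + (j\<^sup>2 + 3 * j) div 2)
              / (qpoch q q (2 * i + 1) * qpoch q q j))" for i j
    unfolding f_def prod.case parity_exponents
    by (simp only: power_add[of p 1] power_mult[of p 2] q power_one_right times_divide_eq_right)
  then have "((\<lambda>z. p * (case z of (i, j) \<Rightarrow> q ^ (2 * i\<^sup>2 + 2 * i * j + 2 * i + (j\<^sup>2 + 3 * j) div 2)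
              / (qpoch q q (2 * i + 1) * qpoch q q j))) has_sum (p * (?B / rr_denom1 q))) UNIV"
    using od by (simp add: split_def add_divide_distrib diff_divide_distrib)
  then show "((\<lambda>(i, j). q ^ (2 * i\<^sup>2 + 2 * i * j + 2 * i + (j\<^sup>2 + 3 * j) div 2)
              / (qpoch q q (2 * i + 1) * qpoch q q j))
            has_sum (theta (q ^ 4) (q ^ 16) / rr_denom1 q)) UNIV"
    using \<open>p \<noteq> 0\<close> by (subst (asm) has_sum_cmult_right_iff) auto
qed

lemma parity_sums_2:
  fixes p q :: complex
  assumes p: "norm p < 1" and q: "q = p\<^sup>2" and "p \<noteq> 0"
  shows "((\<lambda>(i, j). q ^ (2 * i\<^sup>2 + 2 * i * j + 2 * i + (j\<^sup>2 + j) div 2) / (qpoch q q (2 * i) * qpoch q q j))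
            has_sum (theta (q ^ 8) (q ^ 12) / rr_denom2 q)) UNIV"
    and "((\<lambda>(i, j). q ^ (2 * i\<^sup>2 + 2 * i * j + 4 * i + (j\<^sup>2 + 3 * j) div 2)
              / (qpoch q q (2 * i + 1) * qpoch q q j))
            has_sum (theta (q ^ 2) (q ^ 18) / rr_denom2 q)) UNIV"
proof -
  \<comment> \<open>The surplus \<open>i\<close> sits on the index whose parity is tracked: (j +
    i)^2 + (j + i) is always even, so the surplus alone decides the sign under p -> -p.\<close>
  define f where "f = (\<lambda>(i, j). p ^ ((j + i)\<^sup>2 + (j + i) + i) / (qpoch q q i * qpoch q q j))"
  let ?A = "theta (q ^ 8) (q ^ 12)" and ?B = "theta (q ^ 2) (q ^ 18)"
  \<comment> \<open>The dissection is applied to a^3 with c = a^4; the arguments a^16, a^24, a^36,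
    a^4 are q^8, q^12, q^18, q^2.\<close>
  have dissect: "theta (a ^ 3) (a ^ 7) = ?A + a ^ 3 * ?B" if "norm a < 1" "a\<^sup>2 = q" for a
  proof -
    have "theta (a ^ 3) (a ^ 3 * a ^ 4) = theta ((a ^ 3) ^ 4 * a ^ 4) ((a ^ 3) ^ 4 * (a ^ 4) ^ 3)
        + a ^ 3 * theta ((a ^ 3) ^ 8 * (a ^ 4) ^ 3) (a ^ 4)"
      by (rule theta_dissect) (use that in \<open>auto intro: norm_power_less_one\<close>)
    moreover have "theta (q ^ 18) (q ^ 2) = ?B"
      by (simp add: theta_def mult_ac)
    ultimately show ?thesis
      by (simp add: that(2)[symmetric] flip: power_mult power_add)
  qed
  have sum: "((\<lambda>(i, j). a ^ ((j + i)\<^sup>2 + (j + i) + i) / (qpoch q q i * qpoch q q j)) has_sum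
                ((?A + a ^ 3 * ?B) / rr_denom2 q)) UNIV" if a: "norm a < 1" "a\<^sup>2 = q" for a
  proof -
    have "((\<lambda>(i, j). a ^ ((i + j)\<^sup>2 + (i + j) + j) / (qpoch q q i * qpoch q q j)) has_sum
                ((?A + a ^ 3 * ?B) / rr_denom2 q)) UNIV"
      using has_sum_antidiagonals[OF a(1) _ rogers_ramanujan_2_theta[OF a(1)]]
      unfolding a(2) dissect[OF a] by simp
    then show ?thesis
      by (subst has_sum_reindex_bij_witness[of UNIV prod.swap prod.swap UNIV]) (auto simp: mult.commute)
  qed
  have "(f has_sum (?A + p ^ 3 * ?B) / rr_denom2 q) UNIV"
    unfolding f_def using p q by (intro sum) auto
  moreover have "((\<lambda>(m, j). (- 1) ^ m * f (m, j)) has_sum (?A + (- p) ^ 3 * ?B) / rr_denom2 q) UNIV"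
  proof -
    have "(- p) ^ ((j + m)\<^sup>2 + (j + m) + m) = (- 1) ^ m * p ^ ((j + m)\<^sup>2 + (j + m) + m)" for m j
    proof -
      have "even ((j + m)\<^sup>2 + (j + m) + m) \<longleftrightarrow> even m" by auto
      then show ?thesis by (simp add: uminus_power_if)
    qed
    then have "(\<lambda>(m, j). (- 1) ^ m * f (m, j))
        = (\<lambda>(i, j). (- p) ^ ((j + i)\<^sup>2 + (j + i) + i) / (qpoch q q i * qpoch q q j))"
      by (simp add: f_def)
    then show ?thesis
      using sum[of "- p"] p q by simp
  qed
  ultimately have ev: "((\<lambda>(i, j). f (2 * i, j)) has_sum
        ((?A + p ^ 3 * ?B) / rr_denom2 q + (?A + (- p) ^ 3 * ?B) / rr_denom2 q) / 2) UNIV"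
    and od: "((\<lambda>(i, j). f (2 * i + 1, j)) has_sum
        ((?A + p ^ 3 * ?B) / rr_denom2 q - (?A + (- p) ^ 3 * ?B) / rr_denom2 q) / 2) UNIV"
    by (rule has_sum_parity_split)+
  have "f (2 * i, j) = q ^ (2 * i\<^sup>2 + 2 * i * j + 2 * i + (j\<^sup>2 + j) div 2) / (qpoch q q (2 * i) * qpoch q q j)" for i j
    unfolding f_def prod.case parity_exponents by (simp only: power_mult q)
  then show "((\<lambda>(i, j). q ^ (2 * i\<^sup>2 + 2 * i * j + 2 * i + (j\<^sup>2 + j) div 2) / (qpoch q q (2 * i) * qpoch q q j))
            has_sum (theta (q ^ 8) (q ^ 12) / rr_denom2 q)) UNIV"
    using ev by (simp add: add_divide_distrib diff_divide_distrib)
  have "f (2 * i + 1, j) = p ^ 3 * (q ^ (2 * i\<^sup>2 + 2 * i * j + 4 * i + (j\<^sup>2 + 3 * j) div 2)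
              / (qpoch q q (2 * i + 1) * qpoch q q j))" for i j
    unfolding f_def prod.case parity_exponents
    by (simp only: power_add[of p 3] power_mult[of p 2] q times_divide_eq_right)
  then have "((\<lambda>z. p ^ 3 * (case z of (i, j) \<Rightarrow> q ^ (2 * i\<^sup>2 + 2 * i * j + 4 * i + (j\<^sup>2 + 3 * j) div 2)
              / (qpoch q q (2 * i + 1) * qpoch q q j))) has_sum (p ^ 3 * (?B / rr_denom2 q))) UNIV"
    using od by (simp add: split_def add_divide_distrib diff_divide_distrib)
  then show "((\<lambda>(i, j). q ^ (2 * i\<^sup>2 + 2 * i * j + 4 * i + (j\<^sup>2 + 3 * j) div 2)
              / (qpoch q q (2 * i + 1) * qpoch q q j))
            has_sum (theta (q ^ 2) (q ^ 18) / rr_denom2 q)) UNIV"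
    using \<open>p \<noteq> 0\<close> by (subst (asm) has_sum_cmult_right_iff) auto
qed

lemma qpoch_inf_0_right: "qpoch_inf 0 q = 1"
  by (simp add: qpoch_inf_def)

text \<open>At q = 0 the convention 0^0 = 1 leaves only the term at the origin.\<close>

lemma has_sum_at_zero:
  fixes e :: "nat \<times> nat \<Rightarrow> nat" and d :: "nat \<times> nat \<Rightarrow> complex"
  assumes "\<And>z. e z = 0 \<longleftrightarrow> z = (0, 0)" and "d (0, 0) = 1"
  shows "((\<lambda>z. 0 ^ e z / d z) has_sum 1) UNIV"
proof -
  have "e (0, 0) = 0" "\<And>z. z \<noteq> (0, 0) \<Longrightarrow> 0 < e z"
    using assms(1) by auto
  with assms(2) show ?thesis
    by (intro has_sum_finite_neutralI[of "{(0, 0)}"]) simp_all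
qed

theorem theorem4p1:
  fixes q :: complex
  assumes "norm q < 1"
  shows
    "((\<lambda>(i::nat, j::nat). q ^ (2 * i\<^sup>2 + 2 * i * j + (j\<^sup>2 + j) div 2)
          / (qpoch q q (2 * i) * qpoch q q j))
        has_sum
        (qpochs_inf [q ^ 4, q ^ 16, q ^ 20] (q ^ 20) * qpochs_inf [q ^ 12, q ^ 28] (q ^ 40)
          / qpoch_inf q q)) UNIV
     \<and>
     ((\<lambda>(i::nat, j::nat). q ^ (2 * i\<^sup>2 + 2 * i * j + 2 * i + (j\<^sup>2 + 3 * j) div 2)
          / (qpoch q q (2 * i + 1) * qpoch q q j))
        has_sum
        (qpochs_inf [q ^ 6, q ^ 14, q ^ 20] (q ^ 20) * qpochs_inf [q ^ 8, q ^ 32] (q ^ 40)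
          / qpoch_inf q q)) UNIV
     \<and>
     ((\<lambda>(i::nat, j::nat). q ^ (2 * i\<^sup>2 + 2 * i * j + 2 * i + (j\<^sup>2 + j) div 2)
          / (qpoch q q (2 * i) * qpoch q q j))
        has_sum
        (qpochs_inf [q ^ 2, q ^ 18, q ^ 20] (q ^ 20) * qpochs_inf [q ^ 16, q ^ 24] (q ^ 40)
          / qpoch_inf q q)) UNIV
     \<and>
     ((\<lambda>(i::nat, j::nat). q ^ (2 * i\<^sup>2 + 2 * i * j + 4 * i + (j\<^sup>2 + 3 * j) div 2)
          / (qpoch q q (2 * i + 1) * qpoch q q j))
        has_sum
        (qpochs_inf [q ^ 8, q ^ 12, q ^ 20] (q ^ 20) * qpochs_inf [q ^ 4, q ^ 36] (q ^ 40)
          / qpoch_inf q q)) UNIV"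
proof (cases "q = 0")
  case True
  have zero_iff: "(j\<^sup>2 + j) div 2 = 0 \<longleftrightarrow> j = 0" "(j\<^sup>2 + 3 * j) div 2 = 0 \<longleftrightarrow> j = 0" for j :: nat
  proof -
    have "j \<le> j\<^sup>2" by (simp add: power2_nat_le_imp_le)
    then show "(j\<^sup>2 + j) div 2 = 0 \<longleftrightarrow> j = 0" "(j\<^sup>2 + 3 * j) div 2 = 0 \<longleftrightarrow> j = 0"
      by (auto simp: div_eq_0_iff)
  qed
  show ?thesis
    unfolding True split_def
    by (intro conjI; simp add: qpochs_inf_def qpoch_inf_0_right; intro has_sum_at_zero)
       (auto simp: qpoch_def prod_eq_iff zero_iff)
next
  case False
  \<comment> \<open>Either root would serve: the dissection treats p and -p alike.\<close>
  define p where "p = csqrt q"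
  have p: "norm p < 1" "q = p\<^sup>2" "p \<noteq> 0"
    using assms False by (auto simp: p_def real_sqrt_lt_1_iff)
  show ?thesis
    unfolding theta_div_rr_denom1[OF assms, symmetric] theta_div_rr_denom2[OF assms, symmetric]
    by (intro conjI parity_sums_1[OF p] parity_sums_2[OF p])
qed

end
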